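(* Let $M$ be a finite LTS, $B\subseteq\mathit{Act}$, $\rho$ a regular formula, $\alpha_f,\alpha_e\subseteq\mathit{Act}$, and let $\phi_{off}$ map each $b\in\overline{B}$ to a closed modal $\mu$-calculus formula such that $P_S$ is feasible and a state is $B$-locked if, and only if, it satisfies $\phi_{off}(b)$ for all $b\in\overline{B}$. Then $M$ satisfies $$\neg\langle\rho\cdot\overline{\alpha_f}^{\,*}\rangle\Big(\langle\alpha_e\rangle\mathit{tt}\lor[\overline{B}]\mathit{ff}\lor\bigvee_{\emptyset\neq F\subseteq\overline{B}}\nu X.\Big(\bigwedge_{a\in F}\mu W.\Big(\big(\bigwedge_{b\in\overline{B}\setminus F}\phi_{off}(b)\big)\land\big(\langle\{a\}\setminus\alpha_f\rangle X\lor\langle\overline{\alpha_f}\rangle W\big)\Big)\Big)\Big)$$ if, and only if, its initial state does not admit a path that is $B$-progressing, $(\rho,\alpha_f,\alpha_e)$-violating, and satisfies $P_S$.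
   Context: LTS $M=(S,s_{init},\mathit{Act},\mathit{Trans})$ with $S,\mathit{Act}$ finite; $M$ satisfies a closed formula if $s_{init}$ does. Paths: alternating sequences $s_0t_1s_1\dots$ starting in a state, infinite or ending in a state, consecutive. An action occurs on a path if a transition on it carries that label; $\alpha$-free = no action of $\alpha$ occurs. An action is enabled in $s$ if a transition with that label leaves $s$. $\overline{\alpha}=\mathit{Act}\setminus\alpha$. A state is $B$-locked if all actions enabled in it are in $B$; a path is $B$-progressing if infinite or ending in a $B$-locked state. Given $\phi_{off}$, a path $\pi$ satisfies $P_S$ iff for every $a\in\overline{B}$, $a$ occurs infinitely often on $\pi$ or $\pi$ has a suffix every state of which satisfies $\phi_{off}(a)$. A path predicate is feasible if for every LTS, every finite path can be extended to a path of that LTS satisfying it. Regular formulae $R::=\varepsilon\mid\alpha\mid R\cdot Q\mid R+Q\mid R^*$; a finite path matches $R$ if its label sequence lies in the language of $R$. A path $\pi$ is $(\rho,\alpha_f,\alpha_e)$-violating if $\pi=\pi_{pre}\cdot\pi_{suf}$ with $\pi_{pre}$ finite matching $\rho$ and $\pi_{suf}$ either $\alpha_f$-free, or containing an action of $\alpha_e$ with the prefix before its first such occurrence $\alpha_f$-free. Modal $\mu$-calculus with standard semantics and abbreviations: $\mathit{tt}$, $\land$, $[R]\phi=\neg\langle R\rangle\neg\phi$, $\nu$ greatest fixpoint, $\langle\alpha\rangle\phi=\bigvee_{b\in\alpha}\langle b\rangle\phi$, $\langle R\cdot Q\rangle\phi=\langle R\rangle\langle Q\rangle\phi$, $\langle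 R+Q\rangle\phi=\langle R\rangle\phi\lor\langle Q\rangle\phi$, $\langle R^*\rangle\phi=\mu Y.(\langle R\rangle Y\lor\phi)$, $\langle\varepsilon\rangle\phi=\phi$. *)

theory Defs
  imports Main "HOL-Library.Stream"
begin

type_synonym ('s, 'a) transition = "'s \<times> 'a \<times> 's"

definition src :: "('s, 'a) transition \<Rightarrow> 's" where
  "src t = fst t"

definition act :: "('s, 'a) transition \<Rightarrow> 'a" where
  "act t = fst (snd t)"

definition trgt :: "('s, 'a) transition \<Rightarrow> 's" where
  "trgt t = snd (snd t)"

record ('s, 'a) lts =
  states :: "'s set"
  init :: 's
  acts :: "'a set"
  transitions :: "('s, 'a) transition set"

definition is_lts :: "('s, 'a) lts \<Rightarrow> bool" where
  "is_lts M \<longleftrightarrow> finite (states M) \<and> init M \<in> states M \<and> finite (acts M) \<and>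
     transitions M \<subseteq> states M \<times> acts M \<times> states M"

definition enabled :: "('s, 'a) lts \<Rightarrow> 'a \<Rightarrow> 's \<Rightarrow> bool" where
  "enabled M a s \<longleftrightarrow> (\<exists>t \<in> transitions M. src t = s \<and> act t = a)"

definition locked :: "('s, 'a) lts \<Rightarrow> 'a set \<Rightarrow> 's \<Rightarrow> bool" where
  "locked M B s \<longleftrightarrow> (\<forall>a. enabled M a s \<longrightarrow> a \<in> B)"

text \<open>The path \<open>s\<^sub>0 t\<^sub>1 s\<^sub>1 t\<^sub>2 s\<^sub>2 \<dots>\<close> is represented by its first state and its transitions; each
  later state is the target of the transition before it.\<close>

datatype ('s, 'a) lts_path =
    FinPath 's "('s, 'a) transition list"
  | InfPath 's "('s, 'a) transition stream"

fun consecutive :: "'s \<Rightarrow> ('s, 'a) transition list \<Rightarrow> bool" where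
  "consecutive s [] \<longleftrightarrow> True"
| "consecutive s (t # ts) \<longleftrightarrow> src t = s \<and> consecutive (trgt t) ts"

fun is_path :: "('s, 'a) lts \<Rightarrow> ('s, 'a) lts_path \<Rightarrow> bool" where
  "is_path M (FinPath s ts) \<longleftrightarrow>
     s \<in> states M \<and> set ts \<subseteq> transitions M \<and> consecutive s ts"
| "is_path M (InfPath s ts) \<longleftrightarrow>
     s \<in> states M \<and> sset ts \<subseteq> transitions M \<and> (\<forall>n. consecutive s (stake n ts))"

fun finite_path :: "('s, 'a) lts_path \<Rightarrow> bool" where
  "finite_path (FinPath s ts) \<longleftrightarrow> True"
| "finite_path (InfPath s ts) \<longleftrightarrow> False"

fun first_state :: "('s, 'a) lts_path \<Rightarrow> 's" where
  "first_state (FinPath s ts) = s"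
| "first_state (InfPath s ts) = s"

text \<open>Meaningful for finite paths only; the value on infinite paths is never used.\<close>

fun last_state :: "('s, 'a) lts_path \<Rightarrow> 's" where
  "last_state (FinPath s ts) = (if ts = [] then s else trgt (last ts))"
| "last_state (InfPath s ts) = undefined"

fun path_states :: "('s, 'a) lts_path \<Rightarrow> 's set" where
  "path_states (FinPath s ts) = insert s (trgt ` set ts)"
| "path_states (InfPath s ts) = insert s (trgt ` sset ts)"

fun path_transitions :: "('s, 'a) lts_path \<Rightarrow> ('s, 'a) transition set" where
  "path_transitions (FinPath s ts) = set ts"
| "path_transitions (InfPath s ts) = sset ts"

text \<open>Concatenation; only used (through \<open>splits\<close>) when the left path is finite and its last state
  is the first state of the right path.\<close>

fun path_concat :: "('s, 'a) lts_path \<Rightarrow> ('s, 'a) lts_path \<Rightarrow> ('s, 'a) lts_path" where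
  "path_concat (FinPath s ts) (FinPath s' us) = FinPath s (ts @ us)"
| "path_concat (FinPath s ts) (InfPath s' us) = InfPath s (ts @- us)"
| "path_concat (InfPath s ts) \<pi> = InfPath s ts"

definition splits :: "('s, 'a) lts_path \<Rightarrow> ('s, 'a) lts_path \<Rightarrow> ('s, 'a) lts_path \<Rightarrow> bool" where
  "splits \<pi> \<pi>pre \<pi>suf \<longleftrightarrow>
     finite_path \<pi>pre \<and> last_state \<pi>pre = first_state \<pi>suf \<and> \<pi> = path_concat \<pi>pre \<pi>suf"

definition occurs :: "'a \<Rightarrow> ('s, 'a) lts_path \<Rightarrow> bool" where
  "occurs a \<pi> \<longleftrightarrow> (\<exists>t \<in> path_transitions \<pi>. act t = a)"

fun occurs_inf_often :: "'a \<Rightarrow> ('s, 'a) lts_path \<Rightarrow> bool" where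
  "occurs_inf_often a (FinPath s ts) \<longleftrightarrow> False"
| "occurs_inf_often a (InfPath s ts) \<longleftrightarrow> infinite {n. act (ts !! n) = a}"

definition free_of :: "'a set \<Rightarrow> ('s, 'a) lts_path \<Rightarrow> bool" where
  "free_of \<alpha> \<pi> \<longleftrightarrow> (\<forall>a \<in> \<alpha>. \<not> occurs a \<pi>)"

definition progressing :: "('s, 'a) lts \<Rightarrow> 'a set \<Rightarrow> ('s, 'a) lts_path \<Rightarrow> bool" where
  "progressing M B \<pi> \<longleftrightarrow> \<not> finite_path \<pi> \<or> locked M B (last_state \<pi>)"

datatype 'a regular =
    REps
  | RAct "'a set"
  | RSeq "'a regular" "'a regular"
  | RAlt "'a regular" "'a regular"
  | RStar "'a regular"

fun regular_over :: "'a set \<Rightarrow> 'a regular \<Rightarrow> bool" where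
  "regular_over A REps \<longleftrightarrow> True"
| "regular_over A (RAct \<alpha>) \<longleftrightarrow> \<alpha> \<subseteq> A"
| "regular_over A (RSeq R Q) \<longleftrightarrow> regular_over A R \<and> regular_over A Q"
| "regular_over A (RAlt R Q) \<longleftrightarrow> regular_over A R \<and> regular_over A Q"
| "regular_over A (RStar R) \<longleftrightarrow> regular_over A R"

fun language :: "'a regular \<Rightarrow> 'a list set" where
  "language REps = {[]}"
| "language (RAct \<alpha>) = {[a] | a. a \<in> \<alpha>}"
| "language (RSeq R Q) = {u @ v | u v. u \<in> language R \<and> v \<in> language Q}"
| "language (RAlt R Q) = language R \<union> language Q"
| "language (RStar R) = {concat ws | ws. set ws \<subseteq> language R}"

fun path_matches :: "'a regular \<Rightarrow> ('s, 'a) lts_path \<Rightarrow> bool" where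
  "path_matches R (FinPath s ts) \<longleftrightarrow> map act ts \<in> language R"
| "path_matches R (InfPath s ts) \<longleftrightarrow> False"

text \<open>In the second alternative \<open>t\<close> is the first transition of \<open>\<pi>suf\<close> with a label in \<open>\<alpha>e\<close> and
  \<open>\<pi>1\<close> is the prefix before it.\<close>

definition violating ::
  "'a regular \<Rightarrow> 'a set \<Rightarrow> 'a set \<Rightarrow> ('s, 'a) lts_path \<Rightarrow> bool" where
  "violating \<rho> \<alpha>f \<alpha>e \<pi> \<longleftrightarrow>
     (\<exists>\<pi>pre \<pi>suf. splits \<pi> \<pi>pre \<pi>suf \<and> path_matches \<rho> \<pi>pre \<and>
        (free_of \<alpha>f \<pi>suf \<or>
         (\<exists>\<pi>1 \<pi>2 t \<pi>3. splits \<pi>suf \<pi>1 \<pi>2 \<and> splits \<pi>2 (FinPath (src t) [t]) \<pi>3 \<and>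
            act t \<in> \<alpha>e \<and> free_of \<alpha>e \<pi>1 \<and> free_of \<alpha>f \<pi>1)))"

type_synonym var = nat

datatype 'a formula =
    FF
  | Var var
  | Neg "'a formula"
  | Or "'a formula" "'a formula"
  | Dia 'a "'a formula"
  | Mu var "'a formula"
  | Nu var "'a formula"

fun free_vars :: "'a formula \<Rightarrow> var set" where
  "free_vars FF = {}"
| "free_vars (Var X) = {X}"
| "free_vars (Neg \<phi>) = free_vars \<phi>"
| "free_vars (Or \<phi> \<psi>) = free_vars \<phi> \<union> free_vars \<psi>"
| "free_vars (Dia a \<phi>) = free_vars \<phi>"
| "free_vars (Mu X \<phi>) = free_vars \<phi> - {X}"
| "free_vars (Nu X \<phi>) = free_vars \<phi> - {X}"

text \<open>\<open>polarity True X \<phi>\<close> (\<open>polarity False X \<phi>\<close>): every free occurrence of \<open>X\<close> in \<open>\<phi>\<close> is under an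
  even (odd) number of negations.\<close>

fun polarity :: "bool \<Rightarrow> var \<Rightarrow> 'a formula \<Rightarrow> bool" where
  "polarity p X FF \<longleftrightarrow> True"
| "polarity p X (Var Y) \<longleftrightarrow> (X = Y \<longrightarrow> p)"
| "polarity p X (Neg \<phi>) \<longleftrightarrow> polarity (\<not> p) X \<phi>"
| "polarity p X (Or \<phi> \<psi>) \<longleftrightarrow> polarity p X \<phi> \<and> polarity p X \<psi>"
| "polarity p X (Dia a \<phi>) \<longleftrightarrow> polarity p X \<phi>"
| "polarity p X (Mu Y \<phi>) \<longleftrightarrow> X = Y \<or> polarity p X \<phi>"
| "polarity p X (Nu Y \<phi>) \<longleftrightarrow> X = Y \<or> polarity p X \<phi>"

fun formula_over :: "'a set \<Rightarrow> 'a formula \<Rightarrow> bool" where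
  "formula_over A FF \<longleftrightarrow> True"
| "formula_over A (Var X) \<longleftrightarrow> True"
| "formula_over A (Neg \<phi>) \<longleftrightarrow> formula_over A \<phi>"
| "formula_over A (Or \<phi> \<psi>) \<longleftrightarrow> formula_over A \<phi> \<and> formula_over A \<psi>"
| "formula_over A (Dia a \<phi>) \<longleftrightarrow> a \<in> A \<and> formula_over A \<phi>"
| "formula_over A (Mu X \<phi>) \<longleftrightarrow> polarity True X \<phi> \<and> formula_over A \<phi>"
| "formula_over A (Nu X \<phi>) \<longleftrightarrow> polarity True X \<phi> \<and> formula_over A \<phi>"

definition closed_formula_over :: "'a set \<Rightarrow> 'a formula \<Rightarrow> bool" where
  "closed_formula_over A \<phi> \<longleftrightarrow> formula_over A \<phi> \<and> free_vars \<phi> = {}"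

fun sem :: "('s, 'a) lts \<Rightarrow> 'a formula \<Rightarrow> (var \<Rightarrow> 's set) \<Rightarrow> 's set" where
  "sem M FF e = {}"
| "sem M (Var X) e = e X"
| "sem M (Neg \<phi>) e = states M - sem M \<phi> e"
| "sem M (Or \<phi> \<psi>) e = sem M \<phi> e \<union> sem M \<psi> e"
| "sem M (Dia a \<phi>) e = {s \<in> states M. \<exists>s'. (s, a, s') \<in> transitions M \<and> s' \<in> sem M \<phi> e}"
| "sem M (Mu X \<phi>) e = \<Inter> {T. T \<subseteq> states M \<and> sem M \<phi> (e(X := T)) \<subseteq> T}"
| "sem M (Nu X \<phi>) e = \<Union> {T. T \<subseteq> states M \<and> T \<subseteq> sem M \<phi> (e(X := T))}"

text \<open>Satisfaction of closed formulae, for which the choice of environment is immaterial.\<close>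

definition state_sat :: "('s, 'a) lts \<Rightarrow> 's \<Rightarrow> 'a formula \<Rightarrow> bool" where
  "state_sat M s \<phi> \<longleftrightarrow> s \<in> sem M \<phi> (\<lambda>_. {})"

definition lts_sat :: "('s, 'a) lts \<Rightarrow> 'a formula \<Rightarrow> bool" where
  "lts_sat M \<phi> \<longleftrightarrow> state_sat M (init M) \<phi>"

definition TT :: "'a formula" where
  "TT = Neg FF"

definition And :: "'a formula \<Rightarrow> 'a formula \<Rightarrow> 'a formula" where
  "And \<phi> \<psi> = Neg (Or (Neg \<phi>) (Neg \<psi>))"

text \<open>Conjunctions and disjunctions indexed by a finite set are taken along an arbitrary
  enumeration of the set, on which their semantics does not depend.\<close>

definition enumeration :: "'i set \<Rightarrow> 'i list" where
  "enumeration I = (SOME xs. set xs = I \<and> distinct xs)"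

definition BigOr :: "'i set \<Rightarrow> ('i \<Rightarrow> 'a formula) \<Rightarrow> 'a formula" where
  "BigOr I f = foldr (\<lambda>i \<phi>. Or (f i) \<phi>) (enumeration I) FF"

definition BigAnd :: "'i set \<Rightarrow> ('i \<Rightarrow> 'a formula) \<Rightarrow> 'a formula" where
  "BigAnd I f = foldr (\<lambda>i \<phi>. And (f i) \<phi>) (enumeration I) TT"

definition fresh_var :: "'a formula \<Rightarrow> var" where
  "fresh_var \<phi> = (LEAST Y. Y \<notin> free_vars \<phi>)"

fun RDia :: "'a regular \<Rightarrow> 'a formula \<Rightarrow> 'a formula" where
  "RDia REps \<phi> = \<phi>"
| "RDia (RAct \<alpha>) \<phi> = BigOr \<alpha> (\<lambda>b. Dia b \<phi>)"
| "RDia (RSeq R Q) \<phi> = RDia R (RDia Q \<phi>)"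
| "RDia (RAlt R Q) \<phi> = Or (RDia R \<phi>) (RDia Q \<phi>)"
| "RDia (RStar R) \<phi> = (let Y = fresh_var \<phi> in Mu Y (Or (RDia R (Var Y)) \<phi>))"

definition RBox :: "'a regular \<Rightarrow> 'a formula \<Rightarrow> 'a formula" where
  "RBox R \<phi> = Neg (RDia R (Neg \<phi>))"

definition P_S :: "'a set \<Rightarrow> ('a \<Rightarrow> 'a formula) \<Rightarrow> ('s, 'a) lts \<Rightarrow> ('s, 'a) lts_path \<Rightarrow> bool" where
  "P_S B \<phi>off M \<pi> \<longleftrightarrow>
     (\<forall>a \<in> acts M - B. occurs_inf_often a \<pi> \<or>
        (\<exists>\<pi>pre \<pi>suf. splits \<pi> \<pi>pre \<pi>suf \<and> (\<forall>s \<in> path_states \<pi>suf. state_sat M s (\<phi>off a))))"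

text \<open>Feasibility quantifies over all transition systems with action set \<open>A\<close>. Their states are taken
  to be natural numbers, which loses no generality: transition systems are finite, so each one
  is isomorphic to such a system.\<close>

definition feasible :: "'a set \<Rightarrow> ((nat, 'a) lts \<Rightarrow> (nat, 'a) lts_path \<Rightarrow> bool) \<Rightarrow> bool" where
  "feasible A P \<longleftrightarrow>
     (\<forall>M. is_lts M \<and> acts M = A \<longrightarrow>
        (\<forall>\<pi>. is_path M \<pi> \<and> finite_path \<pi> \<longrightarrow>
           (\<exists>\<pi>' \<pi>suf. is_path M \<pi>' \<and> splits \<pi>' \<pi> \<pi>suf \<and> P M \<pi>')))"

end

theory Submission
  imports Defs "HOL-Library.Infinite_Set"
begin

text \<open>After a finite run matching \<open>\<rho>\<close> followed by \<open>\<alpha>f\<close>-free steps, there are three ways to complete a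
  violating path. An action of \<open>\<alpha>e\<close> may be taken, after which feasibility provides a completion, and
  one satisfying \<open>P_S\<close> is automatically \<open>B\<close>-progressing. The run may stop in a \<open>B\<close>-locked state. Or
  it continues forever without \<open>\<alpha>f\<close>: take \<open>F\<close> to be the set of actions outside \<open>B\<close> that occur
  infinitely often; eventually all other actions outside \<open>B\<close> are off at every state, and the states visited
  from then on form a post-fixpoint of the formula under \<open>\<nu>X\<close>. If \<open>F\<close> is empty, those states are
  \<open>B\<close>-locked, so that this case reduces to the second. Conversely, the segments witnessing the inner least
  fixpoints for all \<open>a \<in> F\<close> are concatenated to one segment, and such segments to an infinite path.\<close>

section \<open>Semantics\<close>

lemma sem_subset_states:
  assumes "\<And>Y. e Y \<subseteq> states M"
  shows "sem M \<phi> e \<subseteq> states M"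
  using assms
proof (induction \<phi> arbitrary: e)
  case (Mu X \<phi>)
  \<comment> \<open>The full state set is a prefixpoint, so the intersection defining
    \<open>Mu\<close> ranges over a nonempty family and is bounded by
    \<open>states M\<close>.\<close>
  have "sem M \<phi> (e(X := states M)) \<subseteq> states M"
    using Mu.prems by (intro Mu.IH) auto
  then show ?case by auto
qed auto

lemma sem_cong:
  assumes "\<And>Y. Y \<in> free_vars \<phi> \<Longrightarrow> e Y = e' Y"
  shows "sem M \<phi> e = sem M \<phi> e'"
  using assms
proof (induction \<phi> arbitrary: e e')
  case (Or \<phi> \<psi>)
  have "sem M \<phi> e = sem M \<phi> e'" "sem M \<psi> e = sem M \<psi> e'"
    using Or.prems by (auto intro!: Or.IH)
  then show ?case by simp
next
  case (Neg \<phi>)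
  have "sem M \<phi> e = sem M \<phi> e'"
    using Neg.prems by (auto intro!: Neg.IH)
  then show ?case by simp
next
  case (Dia a \<phi>)
  have "sem M \<phi> e = sem M \<phi> e'"
    using Dia.prems by (auto intro!: Dia.IH)
  then show ?case by simp
next
  case (Mu X \<phi>)
  have "sem M \<phi> (e(X := T)) = sem M \<phi> (e'(X := T))" for T
    using Mu.prems by (intro Mu.IH) auto
  then show ?case by simp
next
  case (Nu X \<phi>)
  have "sem M \<phi> (e(X := T)) = sem M \<phi> (e'(X := T))" for T
    using Nu.prems by (intro Nu.IH) auto
  then show ?case by simp
qed auto

lemma sem_closed: "free_vars \<phi> = {} \<Longrightarrow> s \<in> sem M \<phi> e \<longleftrightarrow> state_sat M s \<phi>"
  unfolding state_sat_def using sem_cong[of \<phi> e "\<lambda>_. {}" M] by auto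

lemma sem_TT [simp]: "sem M TT e = states M"
  by (simp add: TT_def)

text \<open>Negation complements relative to \<open>states M\<close> while \<open>e\<close> may be
  arbitrary; hence the intersection with \<open>states M\<close>.\<close>

lemma sem_And [simp]: "sem M (And \<phi> \<psi>) e = states M \<inter> sem M \<phi> e \<inter> sem M \<psi> e"
  by (auto simp: And_def)

lemma set_enumeration: "finite I \<Longrightarrow> set (enumeration I) = I"
  unfolding enumeration_def using finite_distinct_list[of I] by (rule someI2_ex) auto

lemma sem_BigOr: "finite I \<Longrightarrow> sem M (BigOr I f) e = (\<Union>i\<in>I. sem M (f i) e)"
proof -
  have "sem M (foldr (\<lambda>i \<phi>. Or (f i) \<phi>) is FF) e = (\<Union>i\<in>set is. sem M (f i) e)" for "is"
    by (induction "is") auto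
  then show "finite I \<Longrightarrow> ?thesis" by (simp add: BigOr_def set_enumeration)
qed

lemma sem_BigAnd: "finite I \<Longrightarrow> sem M (BigAnd I f) e = {s \<in> states M. \<forall>i\<in>I. s \<in> sem M (f i) e}"
proof -
  have "sem M (foldr (\<lambda>i \<phi>. And (f i) \<phi>) is TT) e = {s \<in> states M. \<forall>i\<in>set is. s \<in> sem M (f i) e}"
    for "is"
    by (induction "is") auto
  then show "finite I \<Longrightarrow> ?thesis" by (simp add: BigAnd_def set_enumeration)
qed

lemma free_vars_BigAnd: "finite I \<Longrightarrow> free_vars (BigAnd I f) = (\<Union>i\<in>I. free_vars (f i))"
proof -
  have "free_vars (foldr (\<lambda>i \<phi>. And (f i) \<phi>) is TT) = (\<Union>i\<in>set is. free_vars (f i))" for "is"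
    by (induction "is") (auto simp: And_def TT_def)
  then show "finite I \<Longrightarrow> ?thesis" by (simp add: BigAnd_def set_enumeration)
qed

lemma fresh_var_not_free: "fresh_var \<phi> \<notin> free_vars \<phi>"
proof -
  have "finite (free_vars \<phi>)" by (induction \<phi>) auto
  then have "\<exists>Y. Y \<notin> free_vars \<phi>" by (simp add: ex_new_if_finite)
  then show ?thesis unfolding fresh_var_def by (rule LeastI_ex)
qed

section \<open>Transport of formulas along isomorphisms\<close>

lemma inj_on_image_subset_iff:
  "inj_on h S \<Longrightarrow> A \<subseteq> S \<Longrightarrow> B \<subseteq> S \<Longrightarrow> h ` A \<subseteq> h ` B \<longleftrightarrow> A \<subseteq> B"
  by (simp add: image_subset_iff subset_iff[of A B]) (metis inj_on_image_mem_iff subsetD)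

text \<open>Used to match the families of candidate sets that define \<open>Mu\<close> and
  \<open>Nu\<close> in two isomorphic systems, as every subset of the image of \<open>S\<close> is
  the image of a subset of \<open>S\<close>.\<close>

lemma Collect_subset_image:
  assumes "\<And>T. T \<subseteq> S \<Longrightarrow> Q (h ` T) \<longleftrightarrow> R T"
  shows "{T'. T' \<subseteq> h ` S \<and> Q T'} = (`) h ` {T. T \<subseteq> S \<and> R T}" (is "?A = ?B")
proof
  show "?A \<subseteq> ?B"
  proof
    fix T' assume "T' \<in> ?A"
    then obtain T where "T \<subseteq> S" "T' = h ` T" "Q T'" by (auto elim: subset_imageE)
    with assms show "T' \<in> ?B" by blast
  qed
  show "?B \<subseteq> ?A" using assms by auto
qed

text \<open>Invariance of satisfaction under isomorphism: feasibility speaks about systems over natural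
  numbers only.\<close>

lemma sem_image:
  assumes inj: "inj_on h (states M)"
    and st: "states M' = h ` states M"
    and tr: "transitions M' = map_prod h (map_prod id h) ` transitions M"
    and wf: "transitions M \<subseteq> states M \<times> UNIV \<times> states M"
    and "\<And>Y. e Y \<subseteq> states M"
  shows "sem M' \<phi> (\<lambda>Y. h ` e Y) = h ` sem M \<phi> e"
  using assms(5)
proof (induction \<phi> arbitrary: e)
  case (Neg \<phi>)
  have "h ` (states M - sem M \<phi> e) = h ` states M - h ` sem M \<phi> e"
    by (rule inj_on_image_set_diff[OF inj Diff_subset sem_subset_states[OF Neg.prems]])
  then show ?case using Neg by (simp add: st)
next
  case (Or \<phi> \<psi>)
  then show ?case by (simp add: image_Un)
next
  case (Dia a \<phi>)
  note sub = sem_subset_states[of e M \<phi>, OF Dia.prems]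
  have "(\<exists>s'. (h s, a, s') \<in> transitions M' \<and> s' \<in> h ` sem M \<phi> e) \<longleftrightarrow>
        (\<exists>s'. (s, a, s') \<in> transitions M \<and> s' \<in> sem M \<phi> e)" if s: "s \<in> states M" for s
  proof
    assume "\<exists>s'. (h s, a, s') \<in> transitions M' \<and> s' \<in> h ` sem M \<phi> e"
    then obtain u v w where uv: "(u, a, v) \<in> transitions M" "h s = h u" "h w = h v" "w \<in> sem M \<phi> e"
      by (auto simp: tr)
    \<comment> \<open>Both equations relate images under \<open>h\<close> of states of
      \<open>M\<close>, where \<open>h\<close> is injective.\<close>
    moreover from this have "u = s" "v = w"
      using s wf sub inj_onD[OF inj uv(2)] inj_onD[OF inj uv(3)] by auto
    ultimately show "\<exists>s'. (s, a, s') \<in> transitions M \<and> s' \<in> sem M \<phi> e" by blast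
  next
    assume "\<exists>s'. (s, a, s') \<in> transitions M \<and> s' \<in> sem M \<phi> e"
    then obtain s' where "(s, a, s') \<in> transitions M" "s' \<in> sem M \<phi> e" by blast
    then show "\<exists>s'. (h s, a, s') \<in> transitions M' \<and> s' \<in> h ` sem M \<phi> e"
      unfolding tr by (intro exI[of _ "h s'"]) force
  qed
  then have "{s \<in> states M'. \<exists>s'. (s, a, s') \<in> transitions M' \<and> s' \<in> h ` sem M \<phi> e} =
      h ` {s \<in> states M. \<exists>s'. (s, a, s') \<in> transitions M \<and> s' \<in> sem M \<phi> e}"
    unfolding st by blast
  then show ?case using Dia by simp
next
  case (Mu X \<phi>)
  let ?C = "{T. T \<subseteq> states M \<and> sem M \<phi> (e(X := T)) \<subseteq> T}"
  have upd: "(\<lambda>Y. h ` e Y)(X := h ` T) = (\<lambda>Y. h ` (e(X := T)) Y)" for T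
    by (rule ext) simp
  have eq: "sem M' \<phi> ((\<lambda>Y. h ` e Y)(X := h ` T)) \<subseteq> h ` T \<longleftrightarrow> sem M \<phi> (e(X := T)) \<subseteq> T"
    if T: "T \<subseteq> states M" for T
  proof -
    have e: "\<And>Y. (e(X := T)) Y \<subseteq> states M" using Mu.prems T by auto
    show ?thesis
      unfolding upd Mu.IH[OF e] by (rule inj_on_image_subset_iff[OF inj sem_subset_states[OF e] T])
  qed
  \<comment> \<open>Exchanging image and intersection calls for a nonempty family of sets on which
    \<open>h\<close> is injective; the full state set is a member.\<close>
  have "sem M \<phi> (e(X := states M)) \<subseteq> states M" using Mu.prems by (intro sem_subset_states) auto
  then have C: "states M \<in> ?C" by simp
  have "\<forall>T\<in>?C. T \<subseteq> states M" by simp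
  then have "h ` \<Inter> ((\<lambda>T. T) ` ?C) = \<Inter> ((`) h ` ?C)"
    by (rule image_INT[OF inj _ C])
  moreover have "{T'. T' \<subseteq> states M' \<and> sem M' \<phi> ((\<lambda>Y. h ` e Y)(X := T')) \<subseteq> T'} = (`) h ` ?C"
    unfolding st by (rule Collect_subset_image) (rule eq)
  ultimately show ?case unfolding sem.simps by (simp only: image_ident)
next
  case (Nu X \<phi>)
  let ?C = "{T. T \<subseteq> states M \<and> T \<subseteq> sem M \<phi> (e(X := T))}"
  have upd: "(\<lambda>Y. h ` e Y)(X := h ` T) = (\<lambda>Y. h ` (e(X := T)) Y)" for T
    by (rule ext) simp
  have eq: "h ` T \<subseteq> sem M' \<phi> ((\<lambda>Y. h ` e Y)(X := h ` T)) \<longleftrightarrow> T \<subseteq> sem M \<phi> (e(X := T))"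
    if T: "T \<subseteq> states M" for T
  proof -
    have e: "\<And>Y. (e(X := T)) Y \<subseteq> states M" using Nu.prems T by auto
    show ?thesis
      unfolding upd Nu.IH[OF e] by (rule inj_on_image_subset_iff[OF inj T sem_subset_states[OF e]])
  qed
  have "{T'. T' \<subseteq> states M' \<and> T' \<subseteq> sem M' \<phi> ((\<lambda>Y. h ` e Y)(X := T'))} = (`) h ` ?C"
    unfolding st by (rule Collect_subset_image) (rule eq)
  then show ?case unfolding sem.simps by (simp only: image_Union)
qed auto

section \<open>Runs\<close>

text \<open>The end state is an argument, so that runs compose at a shared state and the empty run
  needs no case distinction as in \<open>last_state\<close>.\<close>

fun run :: "('s, 'a) lts \<Rightarrow> 's \<Rightarrow> ('s, 'a) transition list \<Rightarrow> 's \<Rightarrow> bool" where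
  "run M s [] s' \<longleftrightarrow> s = s'"
| "run M s (t # ts) s' \<longleftrightarrow> t \<in> transitions M \<and> src t = s \<and> run M (trgt t) ts s'"

lemma run_append: "run M s (ts @ us) s'' \<longleftrightarrow> (\<exists>s'. run M s ts s' \<and> run M s' us s'')"
  by (induction ts arbitrary: s) auto

lemma run_iff:
  "run M s ts s' \<longleftrightarrow> set ts \<subseteq> transitions M \<and> consecutive s ts \<and> last_state (FinPath s ts) = s'"
  by (induction ts arbitrary: s) auto

lemma is_path_FinPath:
  "is_path M (FinPath s ts) \<longleftrightarrow> s \<in> states M \<and> run M s ts (last_state (FinPath s ts))"
  by (auto simp: run_iff)

lemma transition_states:
  assumes "is_lts M" "t \<in> transitions M"
  shows "src t \<in> states M" "act t \<in> acts M" "trgt t \<in> states M"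
  using assms by (auto simp: is_lts_def src_def act_def trgt_def)

lemma run_states: "is_lts M \<Longrightarrow> run M s ts s' \<Longrightarrow> s \<in> states M \<Longrightarrow> s' \<in> states M"
  by (induction ts arbitrary: s) (auto dest: transition_states)

lemma run_acts: "is_lts M \<Longrightarrow> run M s ts s' \<Longrightarrow> act ` set ts \<subseteq> acts M"
  by (auto simp: run_iff dest: transition_states)

section \<open>Diamonds over actions and regular formulas\<close>

lemma sem_RDia_RAct:
  assumes M: "is_lts M" and \<alpha>: "\<alpha> \<subseteq> acts M"
  shows "sem M (RDia (RAct \<alpha>) \<phi>) e = {s. \<exists>a\<in>\<alpha>. \<exists>s'. (s, a, s') \<in> transitions M \<and> s' \<in> sem M \<phi> e}"
proof -
  have "finite \<alpha>" using assms finite_subset by (auto simp: is_lts_def)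
  then show ?thesis using M by (auto simp: sem_BigOr is_lts_def)
qed

text \<open>Induction on \<open>R\<close>, where only the star needs a fixpoint argument: the set of
  states with a suitable run is a prefixpoint, since a factor may be prepended, and it lies in every
  prefixpoint by induction on the number of factors.\<close>

lemma sem_RDia:
  assumes M: "is_lts M" and "regular_over (acts M) R" and "\<And>Y. e Y \<subseteq> states M"
  shows "sem M (RDia R \<phi>) e =
    {s. \<exists>ts s'. run M s ts s' \<and> map act ts \<in> language R \<and> s' \<in> sem M \<phi> e}"
  using assms(2,3)
proof (induction R arbitrary: \<phi> e)
  case REps
  then show ?case by simp
next
  case (RAct \<alpha>)
  have "(\<exists>ts s'. run M s ts s' \<and> map act ts \<in> language (RAct \<alpha>) \<and> s' \<in> sem M \<phi> e) \<longleftrightarrow>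
        (\<exists>a\<in>\<alpha>. \<exists>s'. (s, a, s') \<in> transitions M \<and> s' \<in> sem M \<phi> e)" for s
  proof
    assume "\<exists>ts s'. run M s ts s' \<and> map act ts \<in> language (RAct \<alpha>) \<and> s' \<in> sem M \<phi> e"
    then obtain t where "t \<in> transitions M" "src t = s" "act t \<in> \<alpha>" "trgt t \<in> sem M \<phi> e"
      by auto
    then show "\<exists>a\<in>\<alpha>. \<exists>s'. (s, a, s') \<in> transitions M \<and> s' \<in> sem M \<phi> e"
      by (cases t) (auto simp: src_def act_def trgt_def)
  next
    assume "\<exists>a\<in>\<alpha>. \<exists>s'. (s, a, s') \<in> transitions M \<and> s' \<in> sem M \<phi> e"
    then obtain a s' where "a \<in> \<alpha>" "(s, a, s') \<in> transitions M" "s' \<in> sem M \<phi> e" by blast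
    then show "\<exists>ts s'. run M s ts s' \<and> map act ts \<in> language (RAct \<alpha>) \<and> s' \<in> sem M \<phi> e"
      by (intro exI[of _ "[(s, a, s')]"] exI[of _ s']) (auto simp: src_def act_def trgt_def)
  qed
  then show ?case using RAct.prems M by (simp add: sem_RDia_RAct del: RDia.simps language.simps)
next
  case (RSeq R Q)
  have "(\<exists>ts s'. run M s ts s' \<and> map act ts \<in> language (RSeq R Q) \<and> s' \<in> sem M \<phi> e) \<longleftrightarrow>
    (\<exists>ts s'. run M s ts s' \<and> map act ts \<in> language R \<and>
      (\<exists>us s''. run M s' us s'' \<and> map act us \<in> language Q \<and> s'' \<in> sem M \<phi> e))" for s
  proof
    assume "\<exists>ts s'. run M s ts s' \<and> map act ts \<in> language (RSeq R Q) \<and> s' \<in> sem M \<phi> e"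
    then obtain ts s' u v where *: "run M s ts s'" "map act ts = u @ v" "u \<in> language R"
      "v \<in> language Q" "s' \<in> sem M \<phi> e" by auto
    then obtain ts1 ts2 where "ts = ts1 @ ts2" "map act ts1 = u" "map act ts2 = v"
      by (auto simp: map_eq_append_conv)
    with * show "\<exists>ts s'. run M s ts s' \<and> map act ts \<in> language R \<and>
      (\<exists>us s''. run M s' us s'' \<and> map act us \<in> language Q \<and> s'' \<in> sem M \<phi> e)"
      by (auto simp: run_append)
  next
    assume "\<exists>ts s'. run M s ts s' \<and> map act ts \<in> language R \<and>
      (\<exists>us s''. run M s' us s'' \<and> map act us \<in> language Q \<and> s'' \<in> sem M \<phi> e)"
    then obtain ts s' us s'' where "run M s ts s'" "map act ts \<in> language R" "run M s' us s''"
      "map act us \<in> language Q" "s'' \<in> sem M \<phi> e" by blast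
    then show "\<exists>ts s'. run M s ts s' \<and> map act ts \<in> language (RSeq R Q) \<and> s' \<in> sem M \<phi> e"
      by (intro exI[of _ "ts @ us"] exI[of _ s'']) (auto simp: run_append)
  qed
  then show ?case using RSeq by simp
next
  case (RAlt R Q)
  then show ?case by auto
next
  case (RStar R)
  define Y where "Y = fresh_var \<phi>"
  let ?S = "{s. \<exists>ts s'. run M s ts s' \<and> map act ts \<in> language (RStar R) \<and> s' \<in> sem M \<phi> e}"
  \<comment> \<open>\<open>Y\<close> is fresh for \<open>\<phi>\<close>, so the value of
    \<open>\<phi>\<close> stays constant while that of \<open>Y\<close> varies.\<close>
  have \<phi>: "sem M \<phi> (e(Y := T)) = sem M \<phi> e" for T
    using fresh_var_not_free by (intro sem_cong) (auto simp: Y_def)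
  have R: "sem M (RDia R (Var Y)) (e(Y := T)) =
      {s. \<exists>ts s'. run M s ts s' \<and> map act ts \<in> language R \<and> s' \<in> T}" if "T \<subseteq> states M" for T
  proof -
    \<comment> \<open>The induction hypothesis is applied in the updated environment, whose values
      are sets of states because \<open>T\<close> is one.\<close>
    have "\<And>Z. (e(Y := T)) Z \<subseteq> states M" using RStar.prems(2) that by simp
    then have "sem M (RDia R (Var Y)) (e(Y := T)) = {s. \<exists>ts s'. run M s ts s' \<and>
        map act ts \<in> language R \<and> s' \<in> sem M (Var Y) (e(Y := T))}"
      using RStar.prems(1) by (intro RStar.IH) simp_all
    then show ?thesis by simp
  qed
  have src: "s \<in> states M" if "run M s ts s'" "s' \<in> states M" for s ts s'
    using that M by (cases ts) (auto dest: transition_states)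
  have S: "?S \<subseteq> states M"
    using sem_subset_states[of e M \<phi>] RStar.prems src by blast
  have pre: "sem M (Or (RDia R (Var Y)) \<phi>) (e(Y := ?S)) \<subseteq> ?S"
  proof
    fix s
    assume s: "s \<in> sem M (Or (RDia R (Var Y)) \<phi>) (e(Y := ?S))"
    show "s \<in> ?S"
    proof (cases "s \<in> sem M \<phi> e")
      case True
      moreover have "[] \<in> language (RStar R)" by (auto intro!: exI[of _ "[]"])
      ultimately show ?thesis
        by (intro CollectI exI[of _ "[]"] exI[of _ s]) (simp del: language.simps)
    next
      case False
      then obtain ts s' us s'' where *: "run M s ts s'" "map act ts \<in> language R" "run M s' us s''"
        "map act us \<in> language (RStar R)" "s'' \<in> sem M \<phi> e"
        using s by (auto simp: \<phi> R[OF S] simp del: language.simps)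
      from *(4) obtain ws where "map act us = concat ws" "set ws \<subseteq> language R" by auto
      then have "map act (ts @ us) \<in> language (RStar R)"
        using *(2) by (auto intro!: exI[of _ "map act ts # ws"])
      with * show ?thesis unfolding mem_Collect_eq
        by (intro exI[of _ "ts @ us"] exI[of _ s'']) (auto simp: run_append simp del: language.simps)
    qed
  qed
  have least: "?S \<subseteq> T" if T: "T \<subseteq> states M" "sem M (Or (RDia R (Var Y)) \<phi>) (e(Y := T)) \<subseteq> T" for T
  proof -
    \<comment> \<open>The list \<open>ws\<close> holds the factors of the label word. The end state
      is in \<open>T\<close> through \<open>\<phi>\<close>, and each factor, taken from the right,
      is one unfolding of the prefixpoint.\<close>
    have "s \<in> T" if "run M s ts s'" "map act ts = concat ws" "set ws \<subseteq> language R" "s' \<in> sem M \<phi> e"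
      for s ts s' ws
      using that
    proof (induction ws arbitrary: s ts)
      case Nil
      then show ?case using T by (auto simp: \<phi>)
    next
      case (Cons w ws)
      then obtain ts1 ts2 where ts: "ts = ts1 @ ts2" "map act ts1 = w" "map act ts2 = concat ws"
        by (auto simp: map_eq_append_conv)
      then obtain u where u: "run M s ts1 u" "run M u ts2 s'"
        using Cons.prems by (auto simp: run_append)
      have "u \<in> T" using Cons ts u by auto
      then have "s \<in> sem M (RDia R (Var Y)) (e(Y := T))"
        unfolding R[OF T(1)] using u ts Cons.prems by auto
      then show ?case using T by auto
    qed
    then show ?thesis by auto
  qed
  have "\<Inter> {T. T \<subseteq> states M \<and> sem M (Or (RDia R (Var Y)) \<phi>) (e(Y := T)) \<subseteq> T} = ?S"
    by (rule antisym[OF Inter_lower Inter_greatest]) (use S pre least in blast)+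
  then show ?case by (simp add: Let_def Y_def)
qed

section \<open>Until properties and the inner least fixpoint\<close>

inductive until ::
  "('s, 'a) lts \<Rightarrow> 's set \<Rightarrow> 'a set \<Rightarrow> 'a set \<Rightarrow> 's set \<Rightarrow> 's \<Rightarrow> bool"
  for M P \<beta> \<alpha> T where
  goal: "s \<in> P \<Longrightarrow> (s, a, s') \<in> transitions M \<Longrightarrow> a \<in> \<alpha> \<Longrightarrow> s' \<in> T \<Longrightarrow> until M P \<beta> \<alpha> T s"
| step: "s \<in> P \<Longrightarrow> (s, b, s') \<in> transitions M \<Longrightarrow> b \<in> \<beta> \<Longrightarrow> until M P \<beta> \<alpha> T s' \<Longrightarrow>
    until M P \<beta> \<alpha> T s"

lemma until_in: "until M P \<beta> \<alpha> T s \<Longrightarrow> s \<in> P"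
  by (erule until.cases) auto

text \<open>The rules of \<open>until\<close> mirror the two disjuncts of the body, so the
  inductively generated set is the least prefixpoint. The conditions on \<open>W\<close> keep the
  values of \<open>\<psi>\<close> and \<open>X\<close> fixed while that of \<open>W\<close>
  varies.\<close>

lemma sem_Mu_until:
  assumes M: "is_lts M" and \<alpha>: "\<alpha> \<subseteq> acts M" and \<beta>: "\<beta> \<subseteq> acts M" and e: "\<And>Y. e Y \<subseteq> states M"
    and W: "W \<noteq> X" "W \<notin> free_vars \<psi>"
  shows "sem M (Mu W (And \<psi> (Or (RDia (RAct \<alpha>) (Var X)) (RDia (RAct \<beta>) (Var W))))) e =
    {s. until M (sem M \<psi> e) \<beta> \<alpha> (e X) s}" (is "?L = {s. ?U s}")
proof -
  have \<psi>: "sem M \<psi> (e(W := T)) = sem M \<psi> e" for T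
    using W by (intro sem_cong) auto
  have sub: "sem M \<psi> e \<subseteq> states M" by (rule sem_subset_states[OF e])
  have L: "?L = \<Inter> {T. T \<subseteq> states M \<and> states M \<inter> sem M \<psi> e \<inter>
      ({s. \<exists>a\<in>\<alpha>. \<exists>s'. (s, a, s') \<in> transitions M \<and> s' \<in> e X} \<union>
       {s. \<exists>a\<in>\<beta>. \<exists>s'. (s, a, s') \<in> transitions M \<and> s' \<in> T}) \<subseteq> T}"
    using W M \<alpha> \<beta> by (simp add: sem_RDia_RAct \<psi> del: RDia.simps)
  show ?thesis unfolding L
  proof (rule antisym[OF Inter_lower Inter_greatest])
    show "{s. ?U s} \<in> {T. T \<subseteq> states M \<and> states M \<inter> sem M \<psi> e \<inter>
      ({s. \<exists>a\<in>\<alpha>. \<exists>s'. (s, a, s') \<in> transitions M \<and> s' \<in> e X} \<union>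
       {s. \<exists>a\<in>\<beta>. \<exists>s'. (s, a, s') \<in> transitions M \<and> s' \<in> T}) \<subseteq> T}"
      using sub by (auto intro: until.intros dest: until_in)
  next
    fix T
    assume T: "T \<in> {T. T \<subseteq> states M \<and> states M \<inter> sem M \<psi> e \<inter>
      ({s. \<exists>a\<in>\<alpha>. \<exists>s'. (s, a, s') \<in> transitions M \<and> s' \<in> e X} \<union>
       {s. \<exists>a\<in>\<beta>. \<exists>s'. (s, a, s') \<in> transitions M \<and> s' \<in> T}) \<subseteq> T}"
    have "s \<in> T" if "?U s" for s
      using that by induction (use T sub in blast)+
    then show "{s. ?U s} \<subseteq> T" by blast
  qed
qed

text \<open>\<open>until\<close> imposes \<open>P\<close> on the source of each step. Every target
  but the last is the source of the next step and so lies in \<open>P\<close>; the last one is only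
  known to lie in \<open>T\<close>.\<close>

lemma until_run:
  assumes "until M P \<beta> \<alpha> T s"
  shows "\<exists>ts s'. run M s ts s' \<and> s' \<in> T \<and> (\<exists>t\<in>set ts. act t \<in> \<alpha>) \<and>
    (\<forall>t\<in>set ts. act t \<in> \<alpha> \<union> \<beta> \<and> trgt t \<in> P \<union> T)"
  using assms
proof induction
  case (goal s a s')
  then show ?case
    by (intro exI[of _ "[(s, a, s')]"] exI[of _ s']) (auto simp: src_def act_def trgt_def)
next
  case (step s b s')
  then obtain ts s'' where "run M s' ts s''" "s'' \<in> T" "\<exists>t\<in>set ts. act t \<in> \<alpha>"
    "\<forall>t\<in>set ts. act t \<in> \<alpha> \<union> \<beta> \<and> trgt t \<in> P \<union> T" by blast
  moreover have "s' \<in> P" using step by (auto dest: until_in)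
  ultimately show ?case using step
    by (intro exI[of _ "(s, b, s') # ts"] exI[of _ s'']) (auto simp: src_def act_def trgt_def)
qed

text \<open>The run obtained for the actions treated so far ends in \<open>T\<close> again, where
  the hypothesis supplies a run for one more action.\<close>

lemma until_run_all:
  assumes "finite F" and "\<And>s a. s \<in> T \<Longrightarrow> a \<in> F \<Longrightarrow> until M P \<beta> (\<alpha> a) T s" and "s \<in> T"
  shows "\<exists>ts s'. run M s ts s' \<and> s' \<in> T \<and> (\<forall>a\<in>F. \<exists>t\<in>set ts. act t \<in> \<alpha> a) \<and>
    (\<forall>t\<in>set ts. act t \<in> \<Union> (\<alpha> ` F) \<union> \<beta> \<and> trgt t \<in> P \<union> T)"
  using assms
proof (induction F arbitrary: s)
  case empty
  then show ?case by (intro exI[of _ "[]"] exI[of _ s]) auto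
next
  case (insert a F)
  then obtain ts s' where 1: "run M s ts s'" "s' \<in> T" "\<forall>a\<in>F. \<exists>t\<in>set ts. act t \<in> \<alpha> a"
    "\<forall>t\<in>set ts. act t \<in> \<Union> (\<alpha> ` F) \<union> \<beta> \<and> trgt t \<in> P \<union> T" by blast
  with insert.prems obtain us s'' where 2: "run M s' us s''" "s'' \<in> T" "\<exists>t\<in>set us. act t \<in> \<alpha> a"
    "\<forall>t\<in>set us. act t \<in> \<alpha> a \<union> \<beta> \<and> trgt t \<in> P \<union> T" using until_run[of M P \<beta> "\<alpha> a" T s'] by blast
  show ?case
    using 1 2 by (intro exI[of _ "ts @ us"] exI[of _ s'']) (auto simp: run_append)
qed

section \<open>Paths\<close>

lemma consecutive_append:
  "consecutive s (ts @ us) \<longleftrightarrow> consecutive s ts \<and> consecutive (last_state (FinPath s ts)) us"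
  by (induction ts arbitrary: s) auto

lemma is_path_InfPath_iff:
  "is_path M (InfPath s \<sigma>) \<longleftrightarrow> s \<in> states M \<and> src (\<sigma> !! 0) = s \<and>
     (\<forall>n. \<sigma> !! n \<in> transitions M \<and> trgt (\<sigma> !! n) = src (\<sigma> !! Suc n))"
proof -
  have "(\<forall>n. consecutive s (stake n \<sigma>)) \<longleftrightarrow>
      src (\<sigma> !! 0) = s \<and> (\<forall>n. trgt (\<sigma> !! n) = src (\<sigma> !! Suc n))" (is "?L \<longleftrightarrow> ?R")
  proof
    assume L: ?L
    have "src (\<sigma> !! 0) = s" using L[rule_format, of "Suc 0"] by simp
    \<comment> \<open>The prefix of length \<open>n + 2\<close> is the first to contain both
      positions.\<close>
    moreover have "trgt (\<sigma> !! n) = src (\<sigma> !! Suc n)" for n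
      using L[rule_format, of "Suc (Suc n)"]
      by (simp add: stake_Suc consecutive_append del: stake.simps)
    ultimately show ?R by blast
  next
    assume R: ?R
    show ?L
    proof
      fix n
      show "consecutive s (stake n \<sigma>)"
      proof (induction n)
        case (Suc n)
        \<comment> \<open>The prefix of length \<open>n\<close> ends in \<open>s\<close> if
          \<open>n = 0\<close>, and otherwise in the target of position
          \<open>n - 1\<close>.\<close>
        then show ?case using R
          by (cases n) (simp_all add: stake_Suc consecutive_append del: stake.simps(2))
      qed simp
    qed
  qed
  then show ?thesis unfolding is_path.simps sset_range by blast
qed

lemma run_stake:
  assumes "is_path M (InfPath s \<sigma>)"
  shows "run M s (stake n \<sigma>) (src (\<sigma> !! n))"
proof (induction n)
  case 0
  then show ?case using assms[unfolded is_path_InfPath_iff] by simp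
next
  case (Suc n)
  then show ?case using assms[unfolded is_path_InfPath_iff]
    by (auto simp: stake_Suc run_append simp del: stake.simps)
qed

lemma is_path_concat:
  assumes "is_path M (FinPath s ts)" "is_path M \<pi>" "last_state (FinPath s ts) = first_state \<pi>"
  shows "is_path M (path_concat (FinPath s ts) \<pi>)"
proof (cases \<pi>)
  case (FinPath s' us)
  then show ?thesis using assms by (auto simp: consecutive_append)
next
  case (InfPath s' \<sigma>)
  have "consecutive s (stake n (ts @- \<sigma>))" for n
  proof -
    have "consecutive s (take n ts @ drop n ts)" using assms by simp
    then have "consecutive s (take n ts)" unfolding consecutive_append by blast
    moreover have "consecutive (last_state (FinPath s ts)) (stake (n - length ts) \<sigma>)"
      using assms InfPath by simp
    ultimately show ?thesis
      by (cases "n \<le> length ts") (simp_all add: stake_shift consecutive_append)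
  qed
  then show ?thesis using assms InfPath by auto
qed

lemma is_path_splitsD:
  assumes M: "is_lts M" and \<pi>: "is_path M \<pi>" and spl: "splits \<pi> \<pi>1 \<pi>2"
  shows "is_path M \<pi>1" "is_path M \<pi>2" "first_state \<pi>1 = first_state \<pi>"
proof -
  obtain s ts where 1: "\<pi>1 = FinPath s ts" using spl by (cases \<pi>1) (auto simp: splits_def)
  have c: "\<pi> = path_concat (FinPath s ts) \<pi>2" "first_state \<pi>2 = last_state (FinPath s ts)"
    using spl 1 by (auto simp: splits_def)
  show fst: "first_state \<pi>1 = first_state \<pi>" using c 1 by (cases \<pi>2) auto
  show p1: "is_path M \<pi>1"
  proof (cases \<pi>2)
    case (FinPath s' us)
    then show ?thesis using \<pi> c 1 by (auto simp: consecutive_append)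
  next
    case (InfPath s' \<sigma>)
    then have "consecutive s (stake (length ts) (ts @- \<sigma>))" using \<pi> c by auto
    then show ?thesis using \<pi> c 1 InfPath by (auto simp: stake_shift)
  qed
  have st: "first_state \<pi>2 \<in> states M"
    using p1 c run_states[OF M] 1 by (metis is_path_FinPath)
  show "is_path M \<pi>2"
  proof (cases \<pi>2)
    case (FinPath s' us)
    then show ?thesis using \<pi> c 1 st by (auto simp: consecutive_append)
  next
    case (InfPath s' \<sigma>)
    have "consecutive s (stake (length ts + n) (ts @- \<sigma>))" for n using \<pi> c InfPath by auto
    then have "consecutive s' (stake n \<sigma>)" for n
      using c InfPath by (simp add: stake_shift consecutive_append split: if_splits)
    then show ?thesis using \<pi> c st InfPath by auto
  qed
qed

text \<open>For each state of \<open>Z\<close> one nonempty segment back into \<open>Z\<close> is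
  chosen, and the segments are chained forever. Properties of the resulting stream follow by strong
  induction on the position, dropping one segment at a time.\<close>

lemma infinite_path_through:
  assumes M: "is_lts M" and Z: "Z \<subseteq> states M"
    and seg: "\<And>s. s \<in> Z \<Longrightarrow> \<exists>ts s'. ts \<noteq> [] \<and> run M s ts s' \<and> s' \<in> Z \<and>
      (\<forall>t\<in>set ts. Q t) \<and> F \<subseteq> act ` set ts"
    and s: "s \<in> Z"
  shows "\<exists>\<sigma>. is_path M (InfPath s \<sigma>) \<and> (\<forall>t\<in>sset \<sigma>. Q t) \<and>
    (\<forall>a\<in>F. occurs_inf_often a (InfPath s \<sigma>))"
proof -
  obtain blk nxt where seg: "\<And>s. s \<in> Z \<Longrightarrow> blk s \<noteq> [] \<and> run M s (blk s) (nxt s) \<and> nxt s \<in> Z \<and>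
      (\<forall>t\<in>set (blk s). Q t) \<and> F \<subseteq> act ` set (blk s)"
    using seg by metis
  \<comment> \<open>The segments chosen at \<open>s\<close>, \<open>nxt s\<close>,
    \<open>nxt (nxt s)\<close> and so on, flattened into one stream; \<open>flat\<close> unfolds as
    expected because all of them are nonempty.\<close>
  define str where "str s = flat (smap blk (siterate nxt s))" for s
  have str: "str s = blk s @- str (nxt s)" if "s \<in> Z" for s
    unfolding str_def using seg[OF that] by (subst siterate.code) (simp add: flat_Stream)
  have Q: "str s !! n \<in> transitions M \<and> Q (str s !! n)" if "s \<in> Z" for s n
    using that
  proof (induction n arbitrary: s rule: less_induct)
    case (less n)
    note sg = seg[OF less.prems]
    show ?case
    proof (cases "n < length (blk s)")
      case True
      then have "str s !! n = blk s ! n" "blk s ! n \<in> set (blk s)"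
        by (simp_all add: str[OF less.prems])
      then show ?thesis using sg by (auto simp: run_iff)
    next
      case False
      \<comment> \<open>Relative to the start of the next segment the position is strictly smaller,
        as \<open>blk s\<close> is nonempty.\<close>
      then have "n - length (blk s) < n" using sg by (cases "blk s") auto
      then show ?thesis using less.IH[of "n - length (blk s)" "nxt s"] sg False
        by (subst (1 2) str[OF less.prems]) auto
    qed
  qed
  have cons: "consecutive s (stake n (str s))" if "s \<in> Z" for s n
    using that
  proof (induction n arbitrary: s rule: less_induct)
    case (less n)
    note sg = seg[OF less.prems]
    show ?case
    proof (cases "n \<le> length (blk s)")
      case True
      then have "stake n (str s) = take n (blk s)"
        by (subst str[OF less.prems]) (simp add: stake_shift)
      moreover have "consecutive s (take n (blk s) @ drop n (blk s))"
        using sg by (simp add: run_iff)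
      ultimately show ?thesis unfolding consecutive_append by simp
    next
      case False
      then have "n - length (blk s) < n" using sg by (cases "blk s") auto
      then have "consecutive (nxt s) (stake (n - length (blk s)) (str (nxt s)))"
        using less.IH sg by blast
      then show ?thesis using sg False
        by (subst str[OF less.prems]) (auto simp: stake_shift consecutive_append run_iff)
    qed
  qed
  \<comment> \<open>Every segment contains every action of \<open>F\<close>: for the bound 0 the
    first segment serves, and a larger bound decreases when a segment is skipped.\<close>
  have inf: "\<exists>m\<ge>n. act (str s !! m) = a" if "s \<in> Z" "a \<in> F" for s n a
    using that
  proof (induction n arbitrary: s rule: less_induct)
    case (less n)
    note sg = seg[OF less.prems(1)]
    show ?case
    proof (cases "n = 0")
      case True
      obtain m where "m < length (blk s)" "act (blk s ! m) = a"
        using sg less.prems(2) by (auto simp: in_set_conv_nth dest!: subsetD)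
      then show ?thesis using True
        by (intro exI[of _ m]) (subst str[OF less.prems(1)], auto)
    next
      case False
      then have "n - length (blk s) < n" using sg by (cases "blk s") auto
      then obtain m where "m \<ge> n - length (blk s)" "act (str (nxt s) !! m) = a"
        using less.IH less.prems sg by blast
      then show ?thesis
        by (intro exI[of _ "m + length (blk s)"]) (subst str[OF less.prems(1)], auto)
    qed
  qed
  show ?thesis
    using Q[OF s] cons[OF s] inf[OF s] s Z
    by (intro exI[of _ "str s"]) (auto simp: sset_range infinite_nat_iff_unbounded_le)
qed

section \<open>Concatenation and violating paths\<close>

lemma first_state_concat [simp]: "first_state (path_concat (FinPath s ts) \<pi>) = s"
  by (cases \<pi>) auto

text \<open>The state \<open>s'\<close> is arbitrary because \<open>path_concat\<close> ignores the
  first state of its right argument.\<close>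

lemma path_concat_append:
  "path_concat (FinPath s (ts @ us)) \<pi> = path_concat (FinPath s ts) (path_concat (FinPath s' us) \<pi>)"
  by (cases \<pi>) auto

lemma path_transitions_concat [simp]:
  "path_transitions (path_concat (FinPath s ts) \<pi>) = set ts \<union> path_transitions \<pi>"
  by (cases \<pi>) auto

lemma last_state_in_path_states: "finite_path \<pi> \<Longrightarrow> last_state \<pi> \<in> path_states \<pi>"
  by (cases \<pi>) auto

lemma last_state_splits:
  assumes "splits \<pi> \<pi>1 \<pi>2" "finite_path \<pi>"
  shows "finite_path \<pi>2" "last_state \<pi> = last_state \<pi>2"
  using assms by (cases \<pi>1; cases \<pi>2; auto simp: splits_def)+

lemma free_of_iff: "free_of \<alpha> \<pi> \<longleftrightarrow> (\<forall>t\<in>path_transitions \<pi>. act t \<notin> \<alpha>)"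
  by (auto simp: free_of_def occurs_def)

text \<open>The path is split after \<open>ts\<close>: the steps \<open>us\<close>, which the
  formula consumes before its disjunction, belong to the violating suffix.\<close>

lemma violating_freeI:
  assumes "last_state (FinPath s (ts @ us)) = first_state \<pi>" "map act ts \<in> language \<rho>"
    and "\<forall>t\<in>set us. act t \<notin> \<alpha>f" "free_of \<alpha>f \<pi>"
  shows "violating \<rho> \<alpha>f \<alpha>e (path_concat (FinPath s (ts @ us)) \<pi>)"
proof -
  define s' where "s' = last_state (FinPath s ts)"
  have "splits (path_concat (FinPath s (ts @ us)) \<pi>) (FinPath s ts) (path_concat (FinPath s' us) \<pi>)"
    unfolding path_concat_append[where s' = s'] splits_def s'_def by auto
  moreover have "free_of \<alpha>f (path_concat (FinPath s' us) \<pi>)"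
    using assms by (auto simp: free_of_iff)
  ultimately show ?thesis using assms(2) unfolding violating_def by force
qed

text \<open>The steps \<open>us\<close> may already contain an action of \<open>\<alpha>e\<close>,
  so \<open>t\<close> need not be its first occurrence. The first one lies in
  \<open>us @ [t]\<close>, and what precedes it is part of \<open>us\<close>, hence still free of
  \<open>\<alpha>f\<close>.\<close>

lemma violating_actI:
  assumes "consecutive s (ts @ us @ [t])" "trgt t = first_state \<pi>" "map act ts \<in> language \<rho>"
    and "\<forall>u\<in>set us. act u \<notin> \<alpha>f" "act t \<in> \<alpha>e"
  shows "violating \<rho> \<alpha>f \<alpha>e (path_concat (FinPath s (ts @ us @ [t])) \<pi>)"
proof -
  define s' where "s' = last_state (FinPath s ts)"
  have "\<exists>u\<in>set (us @ [t]). act u \<in> \<alpha>e" using assms by simp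
  then obtain vs u ws where v: "us @ [t] = vs @ u # ws" "act u \<in> \<alpha>e" "\<forall>v\<in>set vs. act v \<notin> \<alpha>e"
    by (rule split_list_first_propE) simp
  \<comment> \<open>If \<open>ws\<close> is empty then \<open>vs\<close> is \<open>us\<close>;
    otherwise \<open>t\<close> is the last element of \<open>ws\<close> and \<open>vs\<close> is a
    prefix of \<open>us\<close>.\<close>
  have vs: "set vs \<subseteq> set us" using v(1) by (cases ws rule: rev_cases) auto
  define \<pi>3 where "\<pi>3 = path_concat (FinPath (trgt u) ws) \<pi>"
  define \<pi>2 where "\<pi>2 = path_concat (FinPath (src u) [u]) \<pi>3"
  define \<pi>suf where "\<pi>suf = path_concat (FinPath s' vs) \<pi>2"
  have "path_concat (FinPath s (ts @ vs @ [u] @ ws)) \<pi> = path_concat (FinPath s ts) \<pi>suf"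
    unfolding \<pi>suf_def \<pi>2_def \<pi>3_def
    by (simp only: path_concat_append[of s ts _ _ s'] path_concat_append[of s' vs _ _ "src u"]
      path_concat_append[of "src u" "[u]" _ _ "trgt u"])
  then have "splits (path_concat (FinPath s (ts @ us @ [t])) \<pi>) (FinPath s ts) \<pi>suf"
    using v(1) by (auto simp: splits_def \<pi>suf_def s'_def)
  \<comment> \<open>This yields that \<open>vs\<close> leads from \<open>s'\<close> to
    \<open>src u\<close>, as the split before \<open>u\<close> demands.\<close>
  moreover have "consecutive s' (vs @ u # ws)"
    using assms(1) v(1) by (simp add: consecutive_append s'_def split: if_splits)
  then have "splits \<pi>suf (FinPath s' vs) \<pi>2"
    unfolding splits_def \<pi>suf_def \<pi>2_def consecutive_append by simp
  moreover have "splits \<pi>2 (FinPath (src u) [u]) \<pi>3"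
    unfolding splits_def \<pi>2_def \<pi>3_def by simp
  moreover have "free_of \<alpha>e (FinPath s' vs)" "free_of \<alpha>f (FinPath s' vs)"
    using v vs assms(4) by (auto simp: free_of_iff)
  moreover have "path_matches \<rho> (FinPath s ts)" using assms by simp
  ultimately show ?thesis using v(2) unfolding violating_def by blast
qed

text \<open>Both kinds of violation are brought into the shape of the formula. For an
  \<open>\<alpha>f\<close>-free suffix, \<open>us\<close> is empty and \<open>\<pi>'\<close> the
  whole suffix; otherwise \<open>us\<close> is the stretch before the action of
  \<open>\<alpha>e\<close>.\<close>

lemma violatingE:
  assumes M: "is_lts M" and \<pi>: "is_path M \<pi>" "first_state \<pi> = s" and "violating \<rho> \<alpha>f \<alpha>e \<pi>"
  obtains ts us \<pi>' where "\<pi> = path_concat (FinPath s (ts @ us)) \<pi>'" "is_path M \<pi>'"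
    "run M s (ts @ us) (first_state \<pi>')" "map act ts \<in> language \<rho>" "\<forall>t\<in>set us. act t \<notin> \<alpha>f"
    "free_of \<alpha>f \<pi>' \<or> (\<exists>t\<in>transitions M. src t = first_state \<pi>' \<and> act t \<in> \<alpha>e)"
proof -
  from assms(4) obtain \<pi>pre \<pi>suf where spl: "splits \<pi> \<pi>pre \<pi>suf" "path_matches \<rho> \<pi>pre"
    and v: "free_of \<alpha>f \<pi>suf \<or>
         (\<exists>\<pi>1 \<pi>2 t \<pi>3. splits \<pi>suf \<pi>1 \<pi>2 \<and> splits \<pi>2 (FinPath (src t) [t]) \<pi>3 \<and>
            act t \<in> \<alpha>e \<and> free_of \<alpha>e \<pi>1 \<and> free_of \<alpha>f \<pi>1)"
    unfolding violating_def by blast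
  note p = is_path_splitsD[OF M \<pi>(1) spl(1)]
  obtain ts where pre: "\<pi>pre = FinPath s ts" "map act ts \<in> language \<rho>"
    using spl(2) p(3) \<pi>(2) by (cases \<pi>pre) auto
  have run: "run M s ts (first_state \<pi>suf)" and eq: "\<pi> = path_concat (FinPath s ts) \<pi>suf"
    using p(1) spl(1) pre(1) by (simp_all add: run_iff splits_def)
  from v show ?thesis
  proof
    assume "free_of \<alpha>f \<pi>suf"
    then show ?thesis using that[of ts "[]" \<pi>suf] eq p(2) pre(2) run by simp
  next
    assume "\<exists>\<pi>1 \<pi>2 t \<pi>3. splits \<pi>suf \<pi>1 \<pi>2 \<and> splits \<pi>2 (FinPath (src t) [t]) \<pi>3 \<and>
            act t \<in> \<alpha>e \<and> free_of \<alpha>e \<pi>1 \<and> free_of \<alpha>f \<pi>1"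
    then obtain \<pi>1 \<pi>2 t \<pi>3 where s: "splits \<pi>suf \<pi>1 \<pi>2" "splits \<pi>2 (FinPath (src t) [t]) \<pi>3"
      "act t \<in> \<alpha>e" "free_of \<alpha>f \<pi>1" by blast
    note q = is_path_splitsD[OF M p(2) s(1)]
    note q2 = is_path_splitsD[OF M q(2) s(2)]
    obtain s' us where us: "\<pi>1 = FinPath s' us"
      using s(1) by (cases \<pi>1) (auto simp: splits_def)
    have "run M s' us (first_state \<pi>2)" "\<pi>suf = path_concat (FinPath s' us) \<pi>2" "first_state \<pi>suf = s'"
      using q(1,3) s(1) unfolding us by (simp_all add: run_iff splits_def)
    moreover from this have "run M s (ts @ us) (first_state \<pi>2)"
      using run by (auto simp: run_append)
    moreover have "src t = first_state \<pi>2" "t \<in> transitions M" using q2 by auto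
    moreover have "\<forall>t\<in>set us. act t \<notin> \<alpha>f" using s(4) us by (simp add: free_of_iff)
    ultimately show ?thesis
      using that[of ts us \<pi>2] q(2) s(3) pre(2) eq path_concat_append[of s ts us \<pi>2 s'] by auto
  qed
qed

section \<open>Feasibility\<close>

text \<open>Stated for inclusions so as to serve both ways: into the copy over natural numbers and
  back.\<close>

lemma is_path_map:
  assumes "is_path M \<pi>" "h ` states M \<subseteq> states M'"
    and "map_prod h (map_prod id h) ` transitions M \<subseteq> transitions M'"
  shows "is_path M' (map_lts_path h id \<pi>)"
proof -
  have c: "consecutive (h s) (map (map_prod h (map_prod id h)) ts)" if "consecutive s ts" for s ts
    using that by (induction ts arbitrary: s) (auto simp: src_def trgt_def)
  show ?thesis
    using assms(1)
  proof (cases \<pi>)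
    case (FinPath s ts)
    have "map_prod h (map_prod id h) ` set ts \<subseteq> transitions M'"
      using assms(1,3) FinPath by (intro subset_trans[OF image_mono assms(3)]) simp
    then show ?thesis using assms(1,2) FinPath by (auto intro!: c)
  next
    case (InfPath s \<sigma>)
    have "map_prod h (map_prod id h) ` sset \<sigma> \<subseteq> transitions M'"
      using assms(1,3) InfPath by (intro subset_trans[OF image_mono assms(3)]) simp
    then show ?thesis using assms(1,2) InfPath by (auto simp: stream.set_map intro!: c)
  qed
qed

lemma trgt_map_prod [simp]: "trgt (map_prod h (map_prod id h) t) = h (trgt t)"
  by (cases t) (simp add: trgt_def)

lemma act_map_prod [simp]: "act (map_prod h (map_prod id h) t) = act t"
  by (cases t) (simp add: act_def)

lemma splits_map:
  assumes "splits \<pi> \<pi>1 \<pi>2"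
  shows "splits (map_lts_path h id \<pi>) (map_lts_path h id \<pi>1) (map_lts_path h id \<pi>2)"
  using assms
  by (cases \<pi>1; cases \<pi>2) (auto simp: splits_def last_map)

lemma path_states_map [simp]: "path_states (map_lts_path h id \<pi>) = h ` path_states \<pi>"
  by (cases \<pi>) (auto simp: stream.set_map image_image)

lemma occurs_inf_often_map [simp]:
  "occurs_inf_often a (map_lts_path h id \<pi>) \<longleftrightarrow> occurs_inf_often a \<pi>"
  by (cases \<pi>) auto

lemma P_S_map:
  assumes "inj_on h (states M)" "states M' = h ` states M" "acts M' = acts M"
    and "transitions M' = map_prod h (map_prod id h) ` transitions M"
    and "transitions M \<subseteq> states M \<times> UNIV \<times> states M"
    and "P_S B \<phi>off M \<pi>"
  shows "P_S B \<phi>off M' (map_lts_path h id \<pi>)"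
proof -
  \<comment> \<open>The constantly empty environment is its own image, so \<open>sem_image\<close>
    applies to \<open>state_sat\<close> directly.\<close>
  have sat: "state_sat M' (h s) \<phi>" if "state_sat M s \<phi>" for s \<phi>
    using sem_image[OF assms(1,2,4,5), of "\<lambda>_. {}" \<phi>] that by (auto simp: state_sat_def)
  show ?thesis unfolding P_S_def
  proof
    fix a
    assume "a \<in> acts M' - B"
    then consider "occurs_inf_often a \<pi>"
      | \<pi>1 \<pi>2 where "splits \<pi> \<pi>1 \<pi>2" "\<forall>s\<in>path_states \<pi>2. state_sat M s (\<phi>off a)"
      using assms(3,6) unfolding P_S_def by blast
    then show "occurs_inf_often a (map_lts_path h id \<pi>) \<or>
        (\<exists>\<pi>1 \<pi>2. splits (map_lts_path h id \<pi>) \<pi>1 \<pi>2 \<and>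
          (\<forall>s\<in>path_states \<pi>2. state_sat M' s (\<phi>off a)))"
    proof cases
      case 2
      then have "splits (map_lts_path h id \<pi>) (map_lts_path h id \<pi>1) (map_lts_path h id \<pi>2) \<and>
          (\<forall>s\<in>path_states (map_lts_path h id \<pi>2). state_sat M' s (\<phi>off a))"
        using sat by (auto intro: splits_map)
      then show ?thesis by blast
    qed simp
  qed
qed

text \<open>The path is carried to an isomorphic copy of \<open>M\<close> over the natural numbers,
  extended there by feasibility, and the extension is carried back.\<close>

lemma feasible_extension:
  assumes M: "is_lts M" and feas: "feasible (acts M) (P_S B \<phi>off)"
    and \<pi>: "is_path M \<pi>" "finite_path \<pi>"
  shows "\<exists>\<pi>' \<pi>suf. is_path M \<pi>' \<and> splits \<pi>' \<pi> \<pi>suf \<and> P_S B \<phi>off M \<pi>'"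
proof -
  obtain f :: "'a \<Rightarrow> nat" where f: "inj_on f (states M)"
    using M finite_imp_inj_to_nat_seg[of "states M"] by (auto simp: is_lts_def)
  define h where "h = inv_into (states M) f"
  define M' where "M' = \<lparr>states = f ` states M, init = f (init M), acts = acts M,
    transitions = map_prod f (map_prod id f) ` transitions M\<rparr>"
  have tr: "transitions M \<subseteq> states M \<times> acts M \<times> states M" using M by (simp add: is_lts_def)
  have M': "is_lts M'" "acts M' = acts M" using M by (auto simp: is_lts_def M'_def)
  have hf: "h (f s) = s" if "s \<in> states M" for s
    using f that by (simp add: h_def)
  have hf_tr: "map_prod h (map_prod id h) (map_prod f (map_prod id f) t) = t" if "t \<in> transitions M" for t
    using tr that hf by (cases t) auto
  have st: "states M = h ` states M'" by (force simp: M'_def image_image hf)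
  have trs: "transitions M = map_prod h (map_prod id h) ` transitions M'"
    using hf_tr by (simp add: M'_def image_image)
  have inj: "inj_on h (states M')"
    unfolding h_def M'_def by (simp add: inj_on_inv_into)
  have "is_path M' (map_lts_path f id \<pi>)"
    using \<pi>(1) by (rule is_path_map) (auto simp: M'_def)
  moreover have "finite_path (map_lts_path f id \<pi>)" using \<pi>(2) by (cases \<pi>) auto
  ultimately obtain \<pi>' \<pi>suf where *: "is_path M' \<pi>'" "splits \<pi>' (map_lts_path f id \<pi>) \<pi>suf"
    "P_S B \<phi>off M' \<pi>'"
    using feas M' unfolding feasible_def by blast
  \<comment> \<open>\<open>h\<close> inverts \<open>f\<close> only on the states of
    \<open>M\<close>; this suffices because \<open>\<pi>\<close> is a path of
    \<open>M\<close>.\<close>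
  have "map_lts_path h id (map_lts_path f id \<pi>) = \<pi>"
    using \<pi> hf hf_tr by (cases \<pi>) (auto intro!: map_idI)
  then have "splits (map_lts_path h id \<pi>') \<pi> (map_lts_path h id \<pi>suf)"
    using splits_map[OF *(2), of h] by simp
  moreover have "is_path M (map_lts_path h id \<pi>')"
    using *(1) by (rule is_path_map) (simp_all add: st[symmetric] trs[symmetric])
  moreover have "P_S B \<phi>off M (map_lts_path h id \<pi>')"
    using M' *(3) by (intro P_S_map[OF inj st _ trs]) (auto simp: is_lts_def)
  ultimately show ?thesis by blast
qed

text \<open>On a finite path no action occurs infinitely often, so for each action outside
  \<open>B\<close> some suffix is off throughout. All these suffixes share the last state, which is
  therefore locked.\<close>

lemma P_S_progressing:
  assumes M: "is_lts M" and \<pi>: "is_path M \<pi>" and "P_S B \<phi>off M \<pi>"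
    and locked: "\<forall>s\<in>states M. (\<forall>b\<in>acts M - B. state_sat M s (\<phi>off b)) \<longrightarrow> locked M B s"
  shows "progressing M B \<pi>"
proof (cases "finite_path \<pi>")
  case True
  have "state_sat M (last_state \<pi>) (\<phi>off b)" if "b \<in> acts M - B" for b
  proof -
    have "\<not> occurs_inf_often b \<pi>" using True by (cases \<pi>) auto
    then obtain \<pi>1 \<pi>2 where "splits \<pi> \<pi>1 \<pi>2" "\<forall>s\<in>path_states \<pi>2. state_sat M s (\<phi>off b)"
      using assms(3) \<open>b \<in> acts M - B\<close> unfolding P_S_def by blast
    then show ?thesis using True last_state_splits last_state_in_path_states by metis
  qed
  moreover have "last_state \<pi> \<in> states M"
    using True \<pi> run_states[OF M] by (cases \<pi>) (auto simp: is_path_FinPath simp del: is_path.simps last_state.simps)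
  ultimately show ?thesis using locked by (simp add: progressing_def)
qed (simp add: progressing_def)

lemma P_S_finite_lockedI:
  assumes "\<forall>b\<in>acts M - B. state_sat M (last_state (FinPath s ts)) (\<phi>off b)"
  shows "P_S B \<phi>off M (FinPath s ts)"
proof -
  let ?s = "last_state (FinPath s ts)"
  \<comment> \<open>The suffix consisting of the last state alone serves for all actions at
    once.\<close>
  have "splits (FinPath s ts) (FinPath s ts) (FinPath ?s [])" by (simp add: splits_def)
  then show ?thesis using assms unfolding P_S_def
    by (intro ballI disjI2 exI[of _ "FinPath s ts"] exI[of _ "FinPath ?s []"]) auto
qed

lemma P_S_InfPath_eventually:
  assumes \<pi>: "is_path M (InfPath s \<sigma>)" and "P_S B \<phi>off M (InfPath s \<sigma>)" "b \<in> acts M - B"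
    and "\<not> occurs_inf_often b (InfPath s \<sigma>)"
  shows "\<exists>N. \<forall>n\<ge>N. state_sat M (src (\<sigma> !! n)) (\<phi>off b)"
proof -
  obtain \<pi>1 \<pi>2 where spl: "splits (InfPath s \<sigma>) \<pi>1 \<pi>2" "\<forall>s\<in>path_states \<pi>2. state_sat M s (\<phi>off b)"
    using assms unfolding P_S_def by blast
  then obtain s1 ts s2 \<tau> where eq: "\<pi>2 = InfPath s2 \<tau>" "\<sigma> = ts @- \<tau>"
    unfolding splits_def by (cases \<pi>1; cases \<pi>2) auto
  \<comment> \<open>The source at \<open>n\<close> is the target at \<open>n - 1\<close>; from
    \<open>Suc (length ts)\<close> on, the latter is the target of a transition of
    \<open>\<tau>\<close>.\<close>
  have "src (\<sigma> !! n) \<in> path_states \<pi>2" if "n \<ge> Suc (length ts)" for n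
  proof -
    obtain m where n: "n = Suc (length ts + m)" using \<open>n \<ge> _\<close> by (auto dest: le_Suc_ex)
    have "src (\<sigma> !! n) = trgt (\<sigma> !! (length ts + m))"
      using \<pi>[unfolded is_path_InfPath_iff] n by simp
    then show ?thesis using eq by (auto simp: sset_range)
  qed
  then show ?thesis using spl(2) by blast
qed

section \<open>The formula\<close>

lemma language_RStar_RAct: "language (RStar (RAct \<alpha>)) = lists \<alpha>"
proof -
  have "concat ws \<in> lists \<alpha>" if "set ws \<subseteq> {[a] | a. a \<in> \<alpha>}" for ws
    using that by fastforce
  moreover have "\<exists>ws. as = concat ws \<and> set ws \<subseteq> {[a] | a. a \<in> \<alpha>}" if "as \<in> lists \<alpha>" for as
    using that by (intro exI[of _ "map (\<lambda>a. [a]) as"]) auto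
  ultimately show ?thesis unfolding language.simps by blast
qed

lemma sem_RDia_star:
  assumes "is_lts M" "regular_over (acts M) \<rho>" "\<alpha> \<subseteq> acts M" "\<And>Y. e Y \<subseteq> states M"
  shows "s \<in> sem M (RDia (RSeq \<rho> (RStar (RAct \<alpha>))) \<phi>) e \<longleftrightarrow>
    (\<exists>ts us s'. run M s (ts @ us) s' \<and> map act ts \<in> language \<rho> \<and> (\<forall>t\<in>set us. act t \<in> \<alpha>) \<and>
      s' \<in> sem M \<phi> e)" (is "_ \<longleftrightarrow> ?R")
proof -
  have "map act ts \<in> language (RSeq \<rho> (RStar (RAct \<alpha>))) \<longleftrightarrow>
      (\<exists>us vs. ts = us @ vs \<and> map act us \<in> language \<rho> \<and> (\<forall>t\<in>set vs. act t \<in> \<alpha>))"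
    for ts :: "('a, 'b) transition list"
    unfolding language.simps(3) language_RStar_RAct
    by (fastforce simp: map_eq_append_conv)
  then show ?thesis
    using assms by (subst sem_RDia) (auto simp del: RDia.simps language.simps)
qed

lemma sem_RBox_FF_iff_locked:
  assumes "is_lts M" "s \<in> states M"
  shows "s \<in> sem M (RBox (RAct (acts M - B)) FF) e \<longleftrightarrow> locked M B s"
proof -
  have "s \<in> sem M (RBox (RAct (acts M - B)) FF) e \<longleftrightarrow>
      \<not> (\<exists>a\<in>acts M - B. \<exists>s'. (s, a, s') \<in> transitions M \<and> s' \<in> states M)"
    using assms by (simp add: RBox_def sem_RDia_RAct del: RDia.simps)
  \<comment> \<open>Labels of transitions lie in \<open>acts M\<close> and their targets in
    \<open>states M\<close>.\<close>
  also have "\<dots> \<longleftrightarrow> locked M B s"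
    using assms(1) by (fastforce simp: locked_def enabled_def is_lts_def src_def act_def)
  finally show ?thesis .
qed

text \<open>A state is in a greatest fixpoint iff some postfixpoint \<open>T\<close> contains it;
  with \<open>X\<close> set to \<open>T\<close>, each inner least fixpoint becomes an
  \<open>until\<close>. As the formulas \<open>\<phi>off b\<close> are closed, they do not depend on
  \<open>X\<close> or \<open>W\<close>.\<close>

lemma sem_Nu_until:
  assumes M: "is_lts M" and F: "F \<subseteq> acts M" and C: "C \<subseteq> acts M" and \<beta>: "\<beta> \<subseteq> acts M"
    and closed: "\<forall>b\<in>C. free_vars (\<phi>off b) = {}" and e: "\<And>Y. e Y \<subseteq> states M" and W: "X \<noteq> W"
  shows "s \<in> sem M (Nu X (BigAnd F (\<lambda>a. Mu W (And (BigAnd C \<phi>off)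
      (Or (RDia (RAct ({a} - \<alpha>)) (Var X)) (RDia (RAct \<beta>) (Var W))))))) e \<longleftrightarrow>
    (\<exists>T\<subseteq>states M. s \<in> T \<and>
      (\<forall>u\<in>T. \<forall>a\<in>F. until M {v\<in>states M. \<forall>b\<in>C. state_sat M v (\<phi>off b)} \<beta> ({a} - \<alpha>) T u))"
proof -
  have fin: "finite F" "finite C" using M F C finite_subset by (auto simp: is_lts_def)
  define \<psi> where "\<psi> = BigAnd F (\<lambda>a. Mu W (And (BigAnd C \<phi>off)
      (Or (RDia (RAct ({a} - \<alpha>)) (Var X)) (RDia (RAct \<beta>) (Var W)))))"
  have \<psi>: "sem M \<psi> (e(X := T)) =
    {u \<in> states M. \<forall>a\<in>F. until M {v\<in>states M. \<forall>b\<in>C. state_sat M v (\<phi>off b)} \<beta> ({a} - \<alpha>) T u}"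
    if T: "T \<subseteq> states M" for T
  proof -
    have e': "\<And>Y. (e(X := T)) Y \<subseteq> states M" using e T by simp
    have C: "sem M (BigAnd C \<phi>off) (e(X := T)) = {v\<in>states M. \<forall>b\<in>C. state_sat M v (\<phi>off b)}"
      using fin closed by (simp add: sem_BigAnd sem_closed)
    have "W \<notin> free_vars (BigAnd C \<phi>off)" using closed fin by (simp add: free_vars_BigAnd)
    then have "sem M (Mu W (And (BigAnd C \<phi>off)
        (Or (RDia (RAct ({a} - \<alpha>)) (Var X)) (RDia (RAct \<beta>) (Var W))))) (e(X := T)) =
        {u. until M {v\<in>states M. \<forall>b\<in>C. state_sat M v (\<phi>off b)} \<beta> ({a} - \<alpha>) T u}"
      if "a \<in> F" for a
      using sem_Mu_until[where e = "e(X := T)", OF M _ \<beta> e', of "{a} - \<alpha>" W X "BigAnd C \<phi>off"]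
        that F W unfolding C by auto
    then show ?thesis using fin by (auto simp: \<psi>_def sem_BigAnd simp del: RDia.simps sem.simps)
  qed
  have "s \<in> sem M (Nu X \<psi>) e \<longleftrightarrow> (\<exists>T\<subseteq>states M. s \<in> T \<and> T \<subseteq> sem M \<psi> (e(X := T)))"
    unfolding sem.simps by blast
  also have "\<dots> \<longleftrightarrow> (\<exists>T\<subseteq>states M. s \<in> T \<and>
      (\<forall>u\<in>T. \<forall>a\<in>F. until M {v\<in>states M. \<forall>b\<in>C. state_sat M v (\<phi>off b)} \<beta> ({a} - \<alpha>) T u))"
    by (intro ex_cong1 conj_cong refl) (use \<psi> in \<open>auto simp: subset_iff\<close>)
  finally show ?thesis unfolding \<psi>_def .
qed

section \<open>Admitted paths\<close>

lemma occurs_inf_often_concat [simp]: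
  "occurs_inf_often a (path_concat (FinPath s ts) \<pi>) \<longleftrightarrow> occurs_inf_often a \<pi>"
proof (cases \<pi>)
  case (InfPath s' \<sigma>)
  have "(\<forall>m. \<exists>n\<ge>m. act ((ts @- \<sigma>) !! n) = a) \<longleftrightarrow> (\<forall>m. \<exists>n\<ge>m. act (\<sigma> !! n) = a)" (is "?L \<longleftrightarrow> ?R")
  proof
    assume L: ?L
    show ?R
    proof
      fix m
      obtain n where "n \<ge> length ts + m" "act ((ts @- \<sigma>) !! n) = a" using L by blast
      then show "\<exists>n\<ge>m. act (\<sigma> !! n) = a" by (intro exI[of _ "n - length ts"]) auto
    qed
  next
    assume R: ?R
    show ?L
    proof
      fix m
      obtain n where "n \<ge> m" "act (\<sigma> !! n) = a" using R by blast
      then show "\<exists>n\<ge>m. act ((ts @- \<sigma>) !! n) = a" by (intro exI[of _ "n + length ts"]) auto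
    qed
  qed
  then show ?thesis using InfPath by (simp add: infinite_nat_iff_unbounded_le)
qed simp

text \<open>Backward induction from the position \<open>m\<close> of an
  \<open>\<alpha>\<close>-action, which gives the goal step, down to \<open>n\<close>; the positions
  in between give \<open>\<beta>\<close>-steps.\<close>

lemma until_along_path:
  assumes \<pi>: "is_path M (InfPath s \<sigma>)" and "n \<le> m" "act (\<sigma> !! m) \<in> \<alpha>"
    and "\<forall>k\<ge>n. src (\<sigma> !! k) \<in> P \<and> src (\<sigma> !! k) \<in> T \<and> act (\<sigma> !! k) \<in> \<beta>"
  shows "until M P \<beta> \<alpha> T (src (\<sigma> !! n))"
proof -
  have tr: "(src (\<sigma> !! k), act (\<sigma> !! k), src (\<sigma> !! Suc k)) \<in> transitions M" for k
  proof -
    have "\<sigma> !! k \<in> transitions M" "trgt (\<sigma> !! k) = src (\<sigma> !! Suc k)"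
      using \<pi>[unfolded is_path_InfPath_iff] by blast+
    then show ?thesis by (metis act_def prod.collapse src_def trgt_def)
  qed
  show ?thesis
    using assms(2,4)
  proof (induction n rule: inc_induct)
    case base
    then show ?case using assms(3) tr[of m] by (intro until.goal) (auto simp del: snth.simps)
  next
    case (step n)
    have "until M P \<beta> \<alpha> T (src (\<sigma> !! Suc n))" using step by auto
    then show ?case using step.prems by (auto intro: until.step[OF _ tr])
  qed
qed

text \<open>Segments serving all of \<open>F\<close> lead from \<open>T\<close> back to
  \<open>T\<close> and are chained. That \<open>F\<close> is nonempty enters twice: it makes the
  segments nonempty, and it puts \<open>T\<close> inside \<open>P\<close>, since every
  \<open>until\<close> starts in \<open>P\<close>.\<close>

lemma fair_cycle_path:
  assumes M: "is_lts M" and F: "F \<noteq> {}" "F \<subseteq> acts M" and T: "T \<subseteq> states M"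
    and until: "\<And>u a. u \<in> T \<Longrightarrow> a \<in> F \<Longrightarrow> until M P (acts M - \<alpha>) ({a} - \<alpha>) T u"
    and s: "s \<in> T"
  shows "\<exists>\<sigma>. is_path M (InfPath s \<sigma>) \<and> free_of \<alpha> (InfPath s \<sigma>) \<and>
    path_states (InfPath s \<sigma>) \<subseteq> P \<and> (\<forall>a\<in>F. occurs_inf_often a (InfPath s \<sigma>))"
proof -
  have fin: "finite F" using M F finite_subset by (auto simp: is_lts_def)
  have TP: "T \<subseteq> P" using until F(1) until_in by fastforce
  have "\<exists>\<sigma>. is_path M (InfPath s \<sigma>) \<and> (\<forall>t\<in>sset \<sigma>. act t \<notin> \<alpha> \<and> trgt t \<in> P) \<and>
    (\<forall>a\<in>F. occurs_inf_often a (InfPath s \<sigma>))"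
  proof (rule infinite_path_through[OF M T _ s])
    fix u assume u: "u \<in> T"
    obtain ts v where run: "run M u ts v" "v \<in> T" and all: "\<forall>a\<in>F. \<exists>t\<in>set ts. act t \<in> {a} - \<alpha>"
      and safe: "\<forall>t\<in>set ts. act t \<in> (\<Union>a\<in>F. {a} - \<alpha>) \<union> (acts M - \<alpha>) \<and> trgt t \<in> P \<union> T"
      using until_run_all[OF fin, of T M P "acts M - \<alpha>" "\<lambda>a. {a} - \<alpha>" u] until u by blast
    have "ts \<noteq> []" using all F(1) by auto
    moreover have "F \<subseteq> act ` set ts" using all by auto
    moreover have "\<forall>t\<in>set ts. act t \<notin> \<alpha> \<and> trgt t \<in> P" using safe TP by blast
    ultimately show "\<exists>ts v. ts \<noteq> [] \<and> run M u ts v \<and> v \<in> T \<and>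
      (\<forall>t\<in>set ts. act t \<notin> \<alpha> \<and> trgt t \<in> P) \<and> F \<subseteq> act ` set ts"
      using run by blast
  qed
  then obtain \<sigma> where "is_path M (InfPath s \<sigma>)" "\<forall>t\<in>sset \<sigma>. act t \<notin> \<alpha> \<and> trgt t \<in> P"
    "\<forall>a\<in>F. occurs_inf_often a (InfPath s \<sigma>)" by blast
  moreover from this have "free_of \<alpha> (InfPath s \<sigma>)" "path_states (InfPath s \<sigma>) \<subseteq> P"
    using s TP by (auto simp: free_of_iff)
  ultimately show ?thesis by blast
qed

text \<open>The meaning of the disjunction under the diamond, with the greatest fixpoint replaced by
  a postfixpoint \<open>T\<close>. It mediates between formula and paths.\<close>

definition continuable ::
  "('s, 'a) lts \<Rightarrow> 'a set \<Rightarrow> ('a \<Rightarrow> 'a formula) \<Rightarrow> 'a set \<Rightarrow> 'a set \<Rightarrow> 's \<Rightarrow> bool" where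
  "continuable M B \<phi>off \<alpha>f \<alpha>e s \<longleftrightarrow>
     (\<exists>t\<in>transitions M. src t = s \<and> act t \<in> \<alpha>e) \<or> locked M B s \<or>
     (\<exists>F T. F \<noteq> {} \<and> F \<subseteq> acts M - B \<and> T \<subseteq> states M \<and> s \<in> T \<and>
       (\<forall>u\<in>T. \<forall>a\<in>F. until M {v\<in>states M. \<forall>b\<in>acts M - B - F. state_sat M v (\<phi>off b)}
          (acts M - \<alpha>f) ({a} - \<alpha>f) T u))"

lemma continuable_admits:
  assumes M: "is_lts M" and feas: "feasible (acts M) (P_S B \<phi>off)"
    and locked: "\<forall>s\<in>states M. locked M B s \<longleftrightarrow> (\<forall>b\<in>acts M - B. state_sat M s (\<phi>off b))"
    and s: "s \<in> states M" and run: "run M s (ts @ us) s'"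
    and ts: "map act ts \<in> language \<rho>" and us: "\<forall>t\<in>set us. act t \<notin> \<alpha>f"
    and s': "continuable M B \<phi>off \<alpha>f \<alpha>e s'"
  shows "\<exists>\<pi>. is_path M \<pi> \<and> first_state \<pi> = s \<and> progressing M B \<pi> \<and>
    violating \<rho> \<alpha>f \<alpha>e \<pi> \<and> P_S B \<phi>off M \<pi>"
proof -
  have last: "last_state (FinPath s (ts @ us)) = s'" and path: "is_path M (FinPath s (ts @ us))"
    using run s by (simp_all add: run_iff)
  have prog: "progressing M B \<pi>" if "is_path M \<pi>" "P_S B \<phi>off M \<pi>" for \<pi>
    using P_S_progressing[OF M that] locked by blast
  have s'_states: "s' \<in> states M" using run_states[OF M run s] .
  from s' consider t where "t \<in> transitions M" "src t = s'" "act t \<in> \<alpha>e" | "locked M B s'"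
    | F T where "F \<noteq> {}" "F \<subseteq> acts M - B" "T \<subseteq> states M" "s' \<in> T"
      "\<And>u a. u \<in> T \<Longrightarrow> a \<in> F \<Longrightarrow> until M {v\<in>states M. \<forall>b\<in>acts M - B - F. state_sat M v (\<phi>off b)}
          (acts M - \<alpha>f) ({a} - \<alpha>f) T u"
    unfolding continuable_def by blast
  then show ?thesis
  proof cases
    case 1
    have run_t: "run M s (ts @ us @ [t]) (trgt t)" using run 1 by (auto simp: run_append)
    then have "is_path M (FinPath s (ts @ us @ [t]))" using s by (simp add: run_iff)
    \<comment> \<open>Once \<open>t\<close> is taken the path is violating whatever follows, so any
      extension supplied by feasibility will do.\<close>
    then obtain \<pi> \<pi>suf where \<pi>: "is_path M \<pi>" "splits \<pi> (FinPath s (ts @ us @ [t])) \<pi>suf" "P_S B \<phi>off M \<pi>"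
      using feasible_extension[OF M feas] by fastforce
    then have eq: "\<pi> = path_concat (FinPath s (ts @ us @ [t])) \<pi>suf" "trgt t = first_state \<pi>suf"
      by (simp_all add: splits_def)
    have "violating \<rho> \<alpha>f \<alpha>e \<pi>" unfolding eq(1)
      using run_t eq(2) ts us 1 by (intro violating_actI) (simp_all add: run_iff)
    moreover have "first_state \<pi> = s" unfolding eq(1) by simp
    ultimately show ?thesis using \<pi>(1,3) prog[OF \<pi>(1,3)] by blast
  next
    case 2
    have "P_S B \<phi>off M (FinPath s (ts @ us))"
      using 2 locked s'_states last by (intro P_S_finite_lockedI) simp
    \<comment> \<open>The finite path is viewed as followed by its one-state suffix, which is
      trivially \<open>\<alpha>f\<close>-free.\<close>
    moreover have "violating \<rho> \<alpha>f \<alpha>e (path_concat (FinPath s (ts @ us)) (FinPath s' []))"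
      using last ts us by (intro violating_freeI) (simp_all add: free_of_iff)
    ultimately show ?thesis using path prog by (intro exI[of _ "FinPath s (ts @ us)"]) simp
  next
    case 3
    have FA: "F \<subseteq> acts M" using 3(2) by blast
    from fair_cycle_path[OF M 3(1) FA 3(3) 3(5) 3(4)] obtain \<sigma>
      where \<sigma>: "is_path M (InfPath s' \<sigma>)" "free_of \<alpha>f (InfPath s' \<sigma>)"
      "path_states (InfPath s' \<sigma>) \<subseteq> {v\<in>states M. \<forall>b\<in>acts M - B - F. state_sat M v (\<phi>off b)}"
      "\<forall>a\<in>F. occurs_inf_often a (InfPath s' \<sigma>)" by blast
    define \<pi> where "\<pi> = path_concat (FinPath s (ts @ us)) (InfPath s' \<sigma>)"
    have "is_path M \<pi>" unfolding \<pi>_def by (rule is_path_concat[OF path \<sigma>(1)]) (simp add: last del: last_state.simps)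
    moreover have "violating \<rho> \<alpha>f \<alpha>e \<pi>" unfolding \<pi>_def
      by (rule violating_freeI[OF _ ts us \<sigma>(2)]) (simp add: last del: last_state.simps)
    moreover have spl: "splits \<pi> (FinPath s (ts @ us)) (InfPath s' \<sigma>)"
      unfolding splits_def \<pi>_def by (simp add: last del: last_state.simps path_concat.simps)
    moreover have "P_S B \<phi>off M \<pi>" unfolding P_S_def
    proof
      fix b assume b: "b \<in> acts M - B"
      show "occurs_inf_often b \<pi> \<or> (\<exists>\<pi>1 \<pi>2. splits \<pi> \<pi>1 \<pi>2 \<and>
          (\<forall>s\<in>path_states \<pi>2. state_sat M s (\<phi>off b)))"
      proof (cases "b \<in> F")
        case True
        then have "occurs_inf_often b \<pi>"
          unfolding \<pi>_def occurs_inf_often_concat using \<sigma>(4) by blast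
        then show ?thesis ..
      next
        case False
        then have "\<forall>s\<in>path_states (InfPath s' \<sigma>). state_sat M s (\<phi>off b)" using \<sigma>(3) b by blast
        with spl show ?thesis by blast
      qed
    qed
    moreover have "first_state \<pi> = s" by (simp add: \<pi>_def del: path_concat.simps)
    ultimately show ?thesis using prog[of \<pi>] by blast
  qed
qed

lemma admits_continuable:
  assumes M: "is_lts M"
    and locked: "\<forall>s\<in>states M. (\<forall>b\<in>acts M - B. state_sat M s (\<phi>off b)) \<longrightarrow> locked M B s"
    and \<pi>: "is_path M \<pi>" "first_state \<pi> = s" "progressing M B \<pi>"
    and viol: "violating \<rho> \<alpha>f \<alpha>e \<pi>" and P_S: "P_S B \<phi>off M \<pi>"
  shows "\<exists>ts us s'. run M s (ts @ us) s' \<and> map act ts \<in> language \<rho> \<and>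
    (\<forall>t\<in>set us. act t \<notin> \<alpha>f) \<and> continuable M B \<phi>off \<alpha>f \<alpha>e s'"
  using M \<pi>(1,2) viol
proof (rule violatingE)
  fix ts us \<pi>'
  assume eq: "\<pi> = path_concat (FinPath s (ts @ us)) \<pi>'" and \<pi>': "is_path M \<pi>'"
    and run: "run M s (ts @ us) (first_state \<pi>')" and ts: "map act ts \<in> language \<rho>"
    and us: "\<forall>t\<in>set us. act t \<notin> \<alpha>f"
    and "free_of \<alpha>f \<pi>' \<or> (\<exists>t\<in>transitions M. src t = first_state \<pi>' \<and> act t \<in> \<alpha>e)"
  then consider "\<exists>t\<in>transitions M. src t = first_state \<pi>' \<and> act t \<in> \<alpha>e"
    | s' vs where "free_of \<alpha>f \<pi>'" "\<pi>' = FinPath s' vs"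
    | s' \<sigma> where "free_of \<alpha>f \<pi>'" "\<pi>' = InfPath s' \<sigma>"
    by (cases \<pi>') auto
  then show ?thesis
  proof cases
    case 1
    then have "continuable M B \<phi>off \<alpha>f \<alpha>e (first_state \<pi>')" by (simp add: continuable_def)
    then show ?thesis using run ts us by blast
  next
    case 2
    \<comment> \<open>A finite remainder is \<open>\<alpha>f\<close>-free and is absorbed into the
      steps after \<open>ts\<close>, which makes its locked end the state sought.\<close>
    define v where "v = last_state (FinPath s' vs)"
    have "run M s' vs v" using \<pi>' 2 by (simp add: run_iff v_def)
    then have run_v: "run M s (ts @ (us @ vs)) v" using run 2 by (auto simp: run_append)
    then have "last_state \<pi> = v" using eq 2 by (simp add: run_iff)
    then have "locked M B v" using \<pi>(3) eq 2 by (simp add: progressing_def del: last_state.simps)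
    then have "continuable M B \<phi>off \<alpha>f \<alpha>e v" by (simp add: continuable_def)
    moreover have "\<forall>t\<in>set (us @ vs). act t \<notin> \<alpha>f" using us 2 by (auto simp: free_of_iff)
    ultimately show ?thesis using run_v ts by blast
  next
    case 3
    define \<tau> where "\<tau> = (ts @ us) @- \<sigma>"
    have \<pi>_eq: "\<pi> = InfPath s \<tau>" using eq 3 by (simp add: \<tau>_def)
    note path = \<pi>(1)[unfolded \<pi>_eq]
    have \<tau>: "\<tau> !! n \<in> transitions M" "src (\<tau> !! n) \<in> states M" "act (\<tau> !! n) \<in> acts M" for n
      using path[unfolded is_path_InfPath_iff] transition_states[OF M] by blast+
    define F where "F = {a\<in>acts M - B. occurs_inf_often a \<pi>}"
    define P where "P = {v\<in>states M. \<forall>b\<in>acts M - B - F. state_sat M v (\<phi>off b)}"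
    have "\<forall>b\<in>acts M - B - F. eventually (\<lambda>n. state_sat M (src (\<tau> !! n)) (\<phi>off b)) sequentially"
      using P_S_InfPath_eventually[OF path P_S[unfolded \<pi>_eq]]
      unfolding eventually_sequentially F_def \<pi>_eq by blast
    moreover have "finite (acts M - B - F)" using M by (simp add: is_lts_def)
    \<comment> \<open>Finitely many eventual properties hold eventually together.\<close>
    ultimately have "eventually (\<lambda>n. \<forall>b\<in>acts M - B - F. state_sat M (src (\<tau> !! n)) (\<phi>off b)) sequentially"
      by (simp add: eventually_ball_finite)
    then obtain k where k: "\<And>n. n \<ge> k \<Longrightarrow> src (\<tau> !! n) \<in> P"
      using \<tau>(2) unfolding eventually_sequentially P_def by blast
    \<comment> \<open>Position \<open>N\<close> lies beyond \<open>ts @ us\<close>, where the path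
      is \<open>\<alpha>f\<close>-free, and beyond \<open>k\<close>, where all actions outside
      \<open>B\<close> and \<open>F\<close> are off.\<close>
    define N where "N = length (ts @ us) + k"
    have N: "src (\<tau> !! n) \<in> P" if "n \<ge> N" for n using k that by (simp add: N_def)
    have free: "act t \<notin> \<alpha>f" if "t \<in> sset \<sigma>" for t using 3 that by (simp add: free_of_iff)
    have free_\<tau>: "act (\<tau> !! n) \<notin> \<alpha>f" if "n \<ge> N" for n
      using that by (intro free) (simp add: \<tau>_def N_def)
    have "stake N \<tau> = ts @ us @ stake k \<sigma>" unfolding \<tau>_def N_def by (simp add: stake_shift)
    then have "run M s (ts @ us @ stake k \<sigma>) (src (\<tau> !! N))" using run_stake[OF path, of N] by simp
    moreover have "set (stake k \<sigma>) \<subseteq> sset \<sigma>" by (metis Un_upper1 sset_shift stake_sdrop)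
    then have "\<forall>t\<in>set (us @ stake k \<sigma>). act t \<notin> \<alpha>f" using us free by auto
    moreover have "continuable M B \<phi>off \<alpha>f \<alpha>e (src (\<tau> !! N))"
    proof (cases "F = {}")
      case True
      \<comment> \<open>With \<open>F\<close> empty, \<open>P\<close> says that every action outside
        \<open>B\<close> is off.\<close>
      then have "locked M B (src (\<tau> !! N))" using N[of N] locked by (simp add: P_def)
      then show ?thesis by (simp add: continuable_def)
    next
      case False
      \<comment> \<open>The postfixpoint: all states visited from \<open>N\<close> on. Each action
        of \<open>F\<close> recurs after every one of them.\<close>
      define T where "T = {src (\<tau> !! n) | n. n \<ge> N}"
      have "until M P (acts M - \<alpha>f) ({a} - \<alpha>f) T u" if "u \<in> T" "a \<in> F" for u a
      proof -
        obtain n where n: "n \<ge> N" "u = src (\<tau> !! n)" using \<open>u \<in> T\<close> by (auto simp: T_def)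
        obtain m where m: "m \<ge> n" "act (\<tau> !! m) = a"
          using \<open>a \<in> F\<close> by (auto simp: F_def \<pi>_eq infinite_nat_iff_unbounded_le)
        have "act (\<tau> !! m) \<in> {a} - \<alpha>f" using m n free_\<tau>[of m] by simp
        moreover have "\<forall>i\<ge>n. src (\<tau> !! i) \<in> P \<and> src (\<tau> !! i) \<in> T \<and> act (\<tau> !! i) \<in> acts M - \<alpha>f"
          using n N free_\<tau> \<tau>(3) by (auto simp: T_def)
        ultimately show ?thesis unfolding n(2) using path m(1) by (intro until_along_path)
      qed
      moreover have "T \<subseteq> states M" "src (\<tau> !! N) \<in> T" using \<tau>(2) by (auto simp: T_def)
      moreover have "F \<subseteq> acts M - B" by (auto simp: F_def)
      ultimately show ?thesis using False unfolding continuable_def P_def by blast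
    qed
    ultimately show ?thesis using ts by blast
  qed
qed

lemma sem_RDia_continuable:
  assumes M: "is_lts M" and \<rho>: "regular_over (acts M) \<rho>" and \<alpha>e: "\<alpha>e \<subseteq> acts M"
    and closed: "\<forall>b\<in>acts M - B. free_vars (\<phi>off b) = {}" and W: "X \<noteq> W"
    and e: "\<And>Y. e Y \<subseteq> states M" and s: "s \<in> states M"
  shows "s \<in> sem M (RDia (RSeq \<rho> (RStar (RAct (acts M - \<alpha>f))))
         (Or (RDia (RAct \<alpha>e) TT)
         (Or (RBox (RAct (acts M - B)) FF)
             (BigOr {F. F \<noteq> {} \<and> F \<subseteq> acts M - B} (\<lambda>F.
                Nu X (BigAnd F (\<lambda>a.
                  Mu W (And (BigAnd (acts M - B - F) \<phi>off)
                            (Or (RDia (RAct ({a} - \<alpha>f)) (Var X))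
                                (RDia (RAct (acts M - \<alpha>f)) (Var W))))))))))) e \<longleftrightarrow>
    (\<exists>ts us s'. run M s (ts @ us) s' \<and> map act ts \<in> language \<rho> \<and>
      (\<forall>t\<in>set us. act t \<notin> \<alpha>f) \<and> continuable M B \<phi>off \<alpha>f \<alpha>e s')"
proof -
  let ?N = "\<lambda>F. Nu X (BigAnd F (\<lambda>a. Mu W (And (BigAnd (acts M - B - F) \<phi>off)
    (Or (RDia (RAct ({a} - \<alpha>f)) (Var X)) (RDia (RAct (acts M - \<alpha>f)) (Var W))))))"
  let ?\<phi> = "Or (RDia (RAct \<alpha>e) TT) (Or (RBox (RAct (acts M - B)) FF)
    (BigOr {F. F \<noteq> {} \<and> F \<subseteq> acts M - B} ?N))"
  \<comment> \<open>The diamond asks for labels in \<open>acts M - \<alpha>f\<close>, the right-hand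
    side only for labels outside \<open>\<alpha>f\<close>; on runs of \<open>M\<close> the two
    agree.\<close>
  have acts: "act t \<in> acts M" if "run M s (ts @ us) s'" "t \<in> set us" for ts us s' t
    using run_acts[OF M that(1)] that(2) by auto
  have "s' \<in> sem M ?\<phi> e \<longleftrightarrow> continuable M B \<phi>off \<alpha>f \<alpha>e s'" if s': "s' \<in> states M" for s'
  proof -
    have "s' \<in> sem M (RDia (RAct \<alpha>e) TT) e \<longleftrightarrow> (\<exists>t\<in>transitions M. src t = s' \<and> act t \<in> \<alpha>e)"
    proof -
      have "v \<in> states M" if "(u, a, v) \<in> transitions M" for u a v
        using M that by (auto simp: is_lts_def)
      then show ?thesis
        unfolding sem_RDia_RAct[OF M \<alpha>e] sem_TT by (auto simp: src_def act_def Bex_def) blast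
    qed
    moreover have "s' \<in> sem M (BigOr {F. F \<noteq> {} \<and> F \<subseteq> acts M - B} ?N) e \<longleftrightarrow>
        (\<exists>F. F \<noteq> {} \<and> F \<subseteq> acts M - B \<and> s' \<in> sem M (?N F) e)"
    proof -
      have "finite {F. F \<noteq> {} \<and> F \<subseteq> acts M - B}"
        using M by (auto intro: rev_finite_subset[of "Pow (acts M)"] simp: is_lts_def)
      then show ?thesis by (simp only: sem_BigOr) blast
    qed
    moreover have "s' \<in> sem M (?N F) e \<longleftrightarrow> (\<exists>T\<subseteq>states M. s' \<in> T \<and>
      (\<forall>u\<in>T. \<forall>a\<in>F. until M {v\<in>states M. \<forall>b\<in>acts M - B - F. state_sat M v (\<phi>off b)}
        (acts M - \<alpha>f) ({a} - \<alpha>f) T u))" if "F \<subseteq> acts M - B" for F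
      using that closed e W by (intro sem_Nu_until[OF M]) auto
    ultimately show ?thesis
      unfolding sem.simps(4) Un_iff continuable_def sem_RBox_FF_iff_locked[OF M s'] by meson
  qed
  moreover have "s' \<in> states M" if "run M s (ts @ us) s'" for ts us s'
    using run_states[OF M that s] .
  ultimately show ?thesis
    unfolding sem_RDia_star[OF M \<rho> Diff_subset e] using acts by blast
qed

theorem theorem56:
  fixes M :: "('s, 'a) lts"
    and B \<alpha>f \<alpha>e :: "'a set"
    and \<rho> :: "'a regular"
    and \<phi>off :: "'a \<Rightarrow> 'a formula"
    and X W :: var
  assumes "is_lts M"
    and "B \<subseteq> acts M"
    and "regular_over (acts M) \<rho>"
    and "\<alpha>f \<subseteq> acts M"
    and "\<alpha>e \<subseteq> acts M"
    and "\<forall>b \<in> acts M - B. closed_formula_over (acts M) (\<phi>off b)"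
    and "feasible (acts M) (P_S B \<phi>off)"
    and "\<forall>s \<in> states M. locked M B s \<longleftrightarrow> (\<forall>b \<in> acts M - B. state_sat M s (\<phi>off b))"
    and "X \<noteq> W"
  shows
    "lts_sat M
       (Neg (RDia (RSeq \<rho> (RStar (RAct (acts M - \<alpha>f))))
         (Or (RDia (RAct \<alpha>e) TT)
         (Or (RBox (RAct (acts M - B)) FF)
             (BigOr {F. F \<noteq> {} \<and> F \<subseteq> acts M - B} (\<lambda>F.
                Nu X (BigAnd F (\<lambda>a.
                  Mu W (And (BigAnd (acts M - B - F) \<phi>off)
                            (Or (RDia (RAct ({a} - \<alpha>f)) (Var X))
                                (RDia (RAct (acts M - \<alpha>f)) (Var W)))))))))))) \<longleftrightarrow>
     \<not> (\<exists>\<pi>. is_path M \<pi> \<and> first_state \<pi> = init M \<and>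
            progressing M B \<pi> \<and> violating \<rho> \<alpha>f \<alpha>e \<pi> \<and> P_S B \<phi>off M \<pi>)"
proof -
  have init: "init M \<in> states M" using assms(1) by (simp add: is_lts_def)
  have closed: "\<forall>b\<in>acts M - B. free_vars (\<phi>off b) = {}"
    using assms(6) by (simp add: closed_formula_over_def)
  have "(\<exists>\<pi>. is_path M \<pi> \<and> first_state \<pi> = init M \<and>
      progressing M B \<pi> \<and> violating \<rho> \<alpha>f \<alpha>e \<pi> \<and> P_S B \<phi>off M \<pi>) \<longleftrightarrow>
    (\<exists>ts us s'. run M (init M) (ts @ us) s' \<and> map act ts \<in> language \<rho> \<and>
      (\<forall>t\<in>set us. act t \<notin> \<alpha>f) \<and> continuable M B \<phi>off \<alpha>f \<alpha>e s')" (is "?L \<longleftrightarrow> ?R")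
  proof
    assume ?L
    then obtain \<pi> where \<pi>: "is_path M \<pi>" "first_state \<pi> = init M" "progressing M B \<pi>"
      "violating \<rho> \<alpha>f \<alpha>e \<pi>" "P_S B \<phi>off M \<pi>" by blast
    show ?R using assms(8) by (intro admits_continuable[OF assms(1) _ \<pi>]) blast
  next
    assume ?R
    then show ?L using continuable_admits[OF assms(1,7,8) init] by blast
  qed
  \<comment> \<open>Negation is complement within \<open>states M\<close>, so \<open>init\<close>
    enters to turn non-membership into satisfaction.\<close>
  then show ?thesis
    unfolding lts_sat_def state_sat_def sem.simps(3)
    using sem_RDia_continuable[OF assms(1,3,5) closed assms(9) _ init, of "\<lambda>_. {}" \<alpha>f] init
    by (simp only: Diff_iff empty_subsetI simp_thms)
qed

end
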